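(* Let $1\le p<\infty$ and let $(X,\mathcal B,\mu,f,T_f)$ be a dissipative composition dynamical system of bounded distortion generated by $W$, with $T_f:L^p(X)\to L^p(X)$, $T_f(\varphi)=\varphi\circ f$. Then $T_f$ is $\mathbb C$-supercyclic if and only if, for every $q\in\mathbb N$, \[ \liminf_{n\to+\infty}\Big(\mu(f^{q-n}(W))\cdot\mu(f^{q+n}(W))\Big)=0 . \]
   Context: Setting: $X$ is a locally compact, $\sigma$-compact, second countable Hausdorff space, $\mathcal B$ is the Borel $\sigma$-algebra of $X$, and $\mu$ is a locally finite Borel measure on $X$ (hence $\sigma$-finite). The map $f:X\to X$ is bijective and bimeasurable (both $f$ and $f^{-1}$ are measurable), and the Radon-Nikodym derivatives of $\mu\circ f$ and of $\mu\circ f^{-1}$ with respect to $\mu$ exist and are bounded from below (by a positive constant). Then $T_f(\varphi)=\varphi\circ f$ is a well-defined bounded invertible linear operator on the space $L^p(X)=L^p(X,\mathcal B,\mu)$ of complex-valued functions, called a composition operator, and $(X,\mathcal B,\mu,f,T_f)$ is called a composition dynamical system. The system is dissipative, generated by $W$, if $W\in\mathcal B$, $0<\mu(W)<\infty$, and $X=\bigcup_{k\in\mathbb Z}f^k(W)$ with the sets $f^k(W)$, $k\in\mathbb Z$, pairwise disjoint. It is of bounded distortion if, in addition, there is $K>0$ such that \[ \frac1K\,\mu(f^k(W))\,\mu(B)\le \mu(f^k(B))\,\mu(W)\le K\,\mu(f^k(W))\,\mu(B) \] for all $k\in\mathbb Z$ and all measurable $B\subseteq W$ with $\mu(B)>0$.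 A bounded linear operator $T$ on a separable complex Banach space $E$ is $\mathbb C$-supercyclic if there is $x\in E$ such that $\{\lambda T^n x: n\ge 0,\ \lambda\in\mathbb C\}$ is dense in $E$. Here $\mathbb N$ denotes the positive integers. *)

theory Defs
  imports "HOL-Analysis.Analysis"
begin

section \<open>The space $L^p$ of complex-valued functions\<close>

definition Lp_fun :: "'a measure \<Rightarrow> real \<Rightarrow> ('a \<Rightarrow> complex) set" where
  "Lp_fun M p = {\<phi> \<in> borel_measurable M. integrable M (\<lambda>x. cmod (\<phi> x) powr p)}"

definition Lp_seminorm :: "'a measure \<Rightarrow> real \<Rightarrow> ('a \<Rightarrow> complex) \<Rightarrow> real" where
  "Lp_seminorm M p \<phi> = (\<integral>x. cmod (\<phi> x) powr p \<partial>M) powr (1 / p)"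

definition Lp_rel :: "'a measure \<Rightarrow> real \<Rightarrow> (('a \<Rightarrow> complex) \<times> ('a \<Rightarrow> complex)) set" where
  "Lp_rel M p = {(\<phi>, \<psi>). \<phi> \<in> Lp_fun M p \<and> \<psi> \<in> Lp_fun M p \<and> (AE x in M. \<phi> x = \<psi> x)}"

definition Lp :: "'a measure \<Rightarrow> real \<Rightarrow> ('a \<Rightarrow> complex) set set" where
  "Lp M p = Lp_fun M p // Lp_rel M p"

text \<open>
  The operations on classes are lifted from representatives; the lemmas below show that they do
  not depend on the chosen representatives.  The guard in \<open>Lp_dist\<close> is there because the locale
  \<open>Metric_space\<close> wants a distance that is nonnegative and symmetric off the carrier, too.
\<close>

definition Lp_dist ::
  "'a measure \<Rightarrow> real \<Rightarrow> ('a \<Rightarrow> complex) set \<Rightarrow> ('a \<Rightarrow> complex) set \<Rightarrow> real" where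
  "Lp_dist M p A B =
    (if A \<in> Lp M p \<and> B \<in> Lp M p
     then the_elem (\<Union>\<phi>\<in>A. \<Union>\<psi>\<in>B. {Lp_seminorm M p (\<lambda>x. \<phi> x - \<psi> x)}) else 0)"

definition Lp_scale ::
  "'a measure \<Rightarrow> real \<Rightarrow> complex \<Rightarrow> ('a \<Rightarrow> complex) set \<Rightarrow> ('a \<Rightarrow> complex) set" where
  "Lp_scale M p c A = (\<Union>\<phi>\<in>A. Lp_rel M p `` {\<lambda>x. c * \<phi> x})"

definition composition_operator ::
  "'a measure \<Rightarrow> real \<Rightarrow> ('a \<Rightarrow> 'a) \<Rightarrow> ('a \<Rightarrow> complex) set \<Rightarrow> ('a \<Rightarrow> complex) set" where
  "composition_operator M p f A = (\<Union>\<phi>\<in>A. Lp_rel M p `` {\<phi> \<circ> f})"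

lemma Lp_fun_measurable: "\<phi> \<in> Lp_fun M p \<Longrightarrow> \<phi> \<in> borel_measurable M"
  by (simp add: Lp_fun_def)

lemma equiv_Lp_rel: "equiv (Lp_fun M p) (Lp_rel M p)"
proof (rule equivI)
  show "Lp_rel M p \<subseteq> Lp_fun M p \<times> Lp_fun M p"
    by (auto simp: Lp_rel_def)
  show "refl_on (Lp_fun M p) (Lp_rel M p)"
    by (auto simp: refl_on_def Lp_rel_def)
  show "sym (Lp_rel M p)"
    by (auto simp: sym_def Lp_rel_def)
  show "trans (Lp_rel M p)"
    by (auto simp: trans_def Lp_rel_def elim: eventually_elim2)
qed

lemma Lp_fun_scale: "\<phi> \<in> Lp_fun M p \<Longrightarrow> (\<lambda>x. c * \<phi> x) \<in> Lp_fun M p"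
  by (auto simp: Lp_fun_def norm_mult powr_mult)

lemma powr_convex_bound:
  fixes x y t p :: real
  assumes "0 \<le> x" "0 \<le> y" "0 < t" "t < 1" "1 \<le> p"
  shows "(t * x + (1 - t) * y) powr p \<le> t * x powr p + (1 - t) * y powr p"
proof -
  have small: "s powr p \<le> s" if "0 < s" "s < 1" for s :: real
    using powr_mono'[of 1 p s] that assms by simp
  consider "x = 0" | "y = 0" | "0 < x" "0 < y"
    using assms by linarith
  then show ?thesis
  proof cases
    case 1
    then show ?thesis
      using assms small[of "1 - t"] by (simp add: powr_mult mult_right_mono)
  next
    case 2
    then show ?thesis
      using assms small[of t] by (simp add: powr_mult mult_right_mono)
  next
    case 3
    then show ?thesis
      using convex_onD[OF powr_convex[OF \<open>1 \<le> p\<close>], of "1 - t" x y] assms by simp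
  qed
qed

lemma Lp_fun_add:
  assumes "1 \<le> p" "\<phi> \<in> Lp_fun M p" "\<psi> \<in> Lp_fun M p"
  shows "(\<lambda>x. \<phi> x + \<psi> x) \<in> Lp_fun M p"
proof -
  have [measurable]: "\<phi> \<in> borel_measurable M" "\<psi> \<in> borel_measurable M"
    using assms by (auto intro: Lp_fun_measurable)
  let ?g = "\<lambda>x. 2 powr p * (cmod (\<phi> x) powr p / 2 + cmod (\<psi> x) powr p / 2)"
  have le: "cmod (\<phi> x + \<psi> x) powr p \<le> ?g x" for x
  proof -
    have "cmod (\<phi> x + \<psi> x) powr p \<le> (2 * (1/2 * cmod (\<phi> x) + (1 - 1/2) * cmod (\<psi> x))) powr p"
      using assms norm_triangle_ineq[of "\<phi> x" "\<psi> x"] by (intro powr_mono2) auto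
    also have "\<dots> = 2 powr p * (1/2 * cmod (\<phi> x) + (1 - 1/2) * cmod (\<psi> x)) powr p"
      by (rule powr_mult)
    also have "\<dots> \<le> 2 powr p * (1/2 * cmod (\<phi> x) powr p + (1 - 1/2) * cmod (\<psi> x) powr p)"
      using assms by (intro mult_left_mono powr_convex_bound) auto
    finally show ?thesis
      by simp
  qed
  have g: "integrable M ?g"
    using assms unfolding Lp_fun_def
    by (intro integrable_mult_right Bochner_Integration.integrable_add integrable_divide) simp_all
  have "integrable M (\<lambda>x. cmod (\<phi> x + \<psi> x) powr p)"
  proof (rule Bochner_Integration.integrable_bound[OF g])
    show "AE x in M. norm (cmod (\<phi> x + \<psi> x) powr p) \<le> norm (?g x)"
      unfolding real_norm_def by (intro AE_I2) (use le in \<open>metis abs_ge_self abs_of_nonneg order_trans powr_ge_zero\<close>)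
  qed measurable
  then show ?thesis
    by (simp add: Lp_fun_def)
qed

lemma Lp_fun_diff:
  assumes "1 \<le> p" "\<phi> \<in> Lp_fun M p" "\<psi> \<in> Lp_fun M p"
  shows "(\<lambda>x. \<phi> x - \<psi> x) \<in> Lp_fun M p"
  using Lp_fun_add[OF assms(1,2) Lp_fun_scale[OF assms(3), of "-1"]] by simp

lemma Lp_seminorm_cong:
  assumes "AE x in M. \<phi> x = \<psi> x" "\<phi> \<in> borel_measurable M" "\<psi> \<in> borel_measurable M"
  shows "Lp_seminorm M p \<phi> = Lp_seminorm M p \<psi>"
proof -
  have "(\<integral>x. cmod (\<phi> x) powr p \<partial>M) = (\<integral>x. cmod (\<psi> x) powr p \<partial>M)"
    using assms by (intro integral_cong_AE) auto
  then show ?thesis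
    by (simp add: Lp_seminorm_def)
qed

lemma Lp_seminorm_eq_0_iff:
  assumes "\<phi> \<in> Lp_fun M p"
  shows "Lp_seminorm M p \<phi> = 0 \<longleftrightarrow> (AE x in M. \<phi> x = 0)"
  using assms
  by (auto simp: Lp_seminorm_def Lp_fun_def integral_nonneg_eq_0_iff_AE)

lemma Lp_seminorm_triangle:
  assumes p: "1 \<le> p" and f: "\<phi> \<in> Lp_fun M p" and g: "\<psi> \<in> Lp_fun M p"
  shows "Lp_seminorm M p (\<lambda>x. \<phi> x + \<psi> x) \<le> Lp_seminorm M p \<phi> + Lp_seminorm M p \<psi>"
proof -
  have [measurable]: "\<phi> \<in> borel_measurable M" "\<psi> \<in> borel_measurable M"
    using assms by (auto intro: Lp_fun_measurable)
  define a where "a = Lp_seminorm M p \<phi>"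
  define b where "b = Lp_seminorm M p \<psi>"
  have "a \<ge> 0" "b \<ge> 0"
    by (auto simp: a_def b_def Lp_seminorm_def)
  then consider "a = 0" | "b = 0" | "0 < a" "0 < b"
    by linarith
  then show ?thesis
  proof cases
    case 1
    then have "AE x in M. \<phi> x = 0"
      using Lp_seminorm_eq_0_iff[OF f] by (simp add: a_def)
    then have "Lp_seminorm M p (\<lambda>x. \<phi> x + \<psi> x) = Lp_seminorm M p \<psi>"
      by (intro Lp_seminorm_cong) auto
    then show ?thesis
      using \<open>a \<ge> 0\<close> by (simp add: a_def)
  next
    case 2
    then have "AE x in M. \<psi> x = 0"
      using Lp_seminorm_eq_0_iff[OF g] by (simp add: b_def)
    then have "Lp_seminorm M p (\<lambda>x. \<phi> x + \<psi> x) = Lp_seminorm M p \<phi>"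
      by (intro Lp_seminorm_cong) auto
    then show ?thesis
      using \<open>b \<ge> 0\<close> by (simp add: b_def)
  next
    case 3
    define t where "t = a / (a + b)"
    have t: "0 < t" "t < 1" "1 - t = b / (a + b)"
      using 3 by (auto simp: t_def field_simps)
    let ?g = "\<lambda>x. (a + b) powr p *
      (t * (cmod (\<phi> x) powr p / a powr p) + (1 - t) * (cmod (\<psi> x) powr p / b powr p))"
    have a': "(\<integral>x. cmod (\<phi> x) powr p \<partial>M) = a powr p"
      using p by (simp add: a_def Lp_seminorm_def powr_powr)
    have b': "(\<integral>x. cmod (\<psi> x) powr p \<partial>M) = b powr p"
      using p by (simp add: b_def Lp_seminorm_def powr_powr)
    have le: "cmod (\<phi> x + \<psi> x) powr p \<le> ?g x" for x
    proof -
      have "(a + b) * (t * (cmod (\<phi> x) / a) + (1 - t) * (cmod (\<psi> x) / b))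
          = cmod (\<phi> x) + cmod (\<psi> x)"
      proof -
        have "(a + b) * t = a" "(a + b) * (1 - t) = b"
          unfolding t(3) using 3 by (auto simp: t_def)
        then have "(a + b) * (t * u + (1 - t) * v) = a * u + b * v" for u v
          by (metis distrib_left mult.assoc)
        from this[of "cmod (\<phi> x) / a" "cmod (\<psi> x) / b"] show ?thesis
          using 3 by simp
      qed
      then have "cmod (\<phi> x + \<psi> x) powr p
          \<le> ((a + b) * (t * (cmod (\<phi> x) / a) + (1 - t) * (cmod (\<psi> x) / b))) powr p"
        using p norm_triangle_ineq[of "\<phi> x" "\<psi> x"] by (intro powr_mono2) auto
      also have "\<dots> = (a + b) powr p * (t * (cmod (\<phi> x) / a) + (1 - t) * (cmod (\<psi> x) / b)) powr p"
        by (rule powr_mult)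
      also have "\<dots> \<le> (a + b) powr p *
          (t * (cmod (\<phi> x) / a) powr p + (1 - t) * (cmod (\<psi> x) / b) powr p)"
        using p t 3 by (intro mult_left_mono powr_convex_bound) auto
      finally show ?thesis
        using 3 by (simp add: powr_divide)
    qed
    have int: "integrable M (\<lambda>x. cmod (\<phi> x) powr p)" "integrable M (\<lambda>x. cmod (\<psi> x) powr p)"
      using f g by (auto simp: Lp_fun_def)
    have "(\<integral>x. cmod (\<phi> x + \<psi> x) powr p \<partial>M) \<le> (\<integral>x. ?g x \<partial>M)"
    proof (intro integral_mono le)
      show "integrable M (\<lambda>x. cmod (\<phi> x + \<psi> x) powr p)"
        using Lp_fun_add[OF p f g] by (simp add: Lp_fun_def)
      show "integrable M ?g"
        by (intro integrable_mult_right Bochner_Integration.integrable_add integrable_divide int)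
    qed
    also have "\<dots> = (a + b) powr p"
      using int 3 by (simp add: a' b')
    finally have "Lp_seminorm M p (\<lambda>x. \<phi> x + \<psi> x) \<le> ((a + b) powr p) powr (1 / p)"
      unfolding Lp_seminorm_def using p by (intro powr_mono2) auto
    also have "\<dots> = a + b"
      using p 3 by (simp add: powr_powr)
    finally show ?thesis
      by (simp add: a_def b_def)
  qed
qed

lemma Lp_dist_class:
  assumes "\<phi> \<in> Lp_fun M p" "\<psi> \<in> Lp_fun M p"
  shows "Lp_dist M p (Lp_rel M p `` {\<phi>}) (Lp_rel M p `` {\<psi>})
    = Lp_seminorm M p (\<lambda>x. \<phi> x - \<psi> x)"
proof -
  have *: "congruent2 (Lp_rel M p) (Lp_rel M p) (\<lambda>\<phi> \<psi>. {Lp_seminorm M p (\<lambda>x. \<phi> x - \<psi> x)})"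
    unfolding congruent2_def
    by (auto simp: Lp_rel_def intro!: Lp_seminorm_cong dest!: Lp_fun_measurable)
  show ?thesis
    unfolding Lp_dist_def UN_equiv_class2[OF equiv_Lp_rel equiv_Lp_rel * assms]
    using assms by (simp add: Lp_def quotientI)
qed

lemma Lp_scale_class:
  assumes "\<phi> \<in> Lp_fun M p"
  shows "Lp_scale M p c (Lp_rel M p `` {\<phi>}) = Lp_rel M p `` {\<lambda>x. c * \<phi> x}"
proof -
  have "congruent (Lp_rel M p) (\<lambda>\<phi>. Lp_rel M p `` {\<lambda>x. c * \<phi> x})"
    unfolding congruent_def
    by (auto intro!: equiv_class_eq[OF equiv_Lp_rel] simp: Lp_rel_def Lp_fun_scale
        elim: eventually_mono)
  then show ?thesis
    using UN_equiv_class[OF equiv_Lp_rel _ assms] by (simp add: Lp_scale_def)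
qed

lemma Metric_space_Lp:
  assumes p: "1 \<le> p"
  shows "Metric_space (Lp M p) (Lp_dist M p)"
proof -
  have off: "Lp_dist M p A B = 0" if "\<not> (A \<in> Lp M p \<and> B \<in> Lp M p)" for A B
    using that by (auto simp: Lp_dist_def)
  have nonneg: "0 \<le> Lp_dist M p A B" for A B
  proof (cases "A \<in> Lp M p \<and> B \<in> Lp M p")
    case True
    then show ?thesis
      by (auto simp: Lp_def Lp_dist_class Lp_seminorm_def elim!: quotientE)
  qed (simp add: off)
  have sym: "Lp_dist M p A B = Lp_dist M p B A" for A B
  proof (cases "A \<in> Lp M p \<and> B \<in> Lp M p")
    case True
    then show ?thesis
      by (auto simp: Lp_def Lp_dist_class Lp_seminorm_def norm_minus_commute elim!: quotientE)
  next
    case False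
    then show ?thesis
      using off[of A B] off[of B A] by auto
  qed
  have zero: "Lp_dist M p A B = 0 \<longleftrightarrow> A = B" if A: "A \<in> Lp M p" and B: "B \<in> Lp M p" for A B
  proof -
    obtain \<phi> \<psi> where *: "\<phi> \<in> Lp_fun M p" "\<psi> \<in> Lp_fun M p"
      "A = Lp_rel M p `` {\<phi>}" "B = Lp_rel M p `` {\<psi>}"
      using A B unfolding Lp_def by (elim quotientE) blast
    have "Lp_dist M p A B = 0 \<longleftrightarrow> (AE x in M. \<phi> x - \<psi> x = 0)"
      using * by (simp add: Lp_dist_class Lp_seminorm_eq_0_iff[OF Lp_fun_diff[OF p *(1,2)]])
    also have "\<dots> \<longleftrightarrow> (\<phi>, \<psi>) \<in> Lp_rel M p"
      using * by (simp add: Lp_rel_def)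
    also have "\<dots> \<longleftrightarrow> A = B"
      using * eq_equiv_class_iff[OF equiv_Lp_rel *(1,2)] by simp
    finally show ?thesis .
  qed
  have tri: "Lp_dist M p A C \<le> Lp_dist M p A B + Lp_dist M p B C"
    if A: "A \<in> Lp M p" and B: "B \<in> Lp M p" and C: "C \<in> Lp M p" for A B C
  proof -
    obtain \<phi> \<psi> \<theta> where *: "\<phi> \<in> Lp_fun M p" "\<psi> \<in> Lp_fun M p" "\<theta> \<in> Lp_fun M p"
      "A = Lp_rel M p `` {\<phi>}" "B = Lp_rel M p `` {\<psi>}" "C = Lp_rel M p `` {\<theta>}"
      using A B C unfolding Lp_def by (elim quotientE) blast
    show ?thesis
      using Lp_seminorm_triangle[OF p Lp_fun_diff[OF p *(1,2)] Lp_fun_diff[OF p *(2,3)]] *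
      by (simp add: Lp_dist_class)
  qed
  show ?thesis
    by (rule Metric_space.intro) (use nonneg sym zero tri in auto)
qed

section \<open>Supercyclicity\<close>

text \<open>
  \<open>E\<close> is the space, \<open>d\<close> its metric, and \<open>smul\<close> its scalar multiplication.
\<close>

definition supercyclic ::
  "'v set \<Rightarrow> ('v \<Rightarrow> 'v \<Rightarrow> real) \<Rightarrow> (complex \<Rightarrow> 'v \<Rightarrow> 'v) \<Rightarrow> ('v \<Rightarrow> 'v) \<Rightarrow> bool" where
  "supercyclic E d smul T \<longleftrightarrow>
    (\<exists>x\<in>E. Metric_space.mtopology E d closure_of {smul c ((T ^^ n) x) | c n. True} = E)"

section \<open>Composition dynamical systems\<close>

definition int_iterate :: "('a \<Rightarrow> 'a) \<Rightarrow> int \<Rightarrow> 'a \<Rightarrow> 'a" where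
  "int_iterate f k = (if 0 \<le> k then f ^^ nat k else inv f ^^ nat (- k))"

definition RN_deriv_bounded_below :: "'a measure \<Rightarrow> 'a measure \<Rightarrow> bool" where
  "RN_deriv_bounded_below M N \<longleftrightarrow>
    density M (RN_deriv M N) = N \<and>
    (\<exists>c::real. 0 < c \<and> (AE x in M. ennreal c \<le> RN_deriv M N x))"

text \<open>
  For bijective \<open>f\<close>, the set function \<open>\<mu> \<circ> f\<close>, \<open>B \<mapsto> \<mu> (f ` B)\<close>, is the push-forward of \<open>\<mu>\<close> under
  \<open>inv f\<close>, and \<open>\<mu> \<circ> f\<^sup>-\<^sup>1\<close> is the push-forward under \<open>f\<close>.
\<close>

locale composition_dynamical_system =
  fixes M :: "'a::{second_countable_topology, t2_space} measure"
    and f :: "'a \<Rightarrow> 'a"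
  assumes locally_compact: "locally_compact_space (euclidean :: 'a topology)"
    and sigma_compact: "\<exists>C :: nat \<Rightarrow> 'a set. (\<forall>n. compact (C n)) \<and> (\<Union>n. C n) = UNIV"
    and sets_eq_borel: "sets M = sets borel"
    and locally_finite: "\<And>x. \<exists>U. open U \<and> x \<in> U \<and> emeasure M U < \<infinity>"
    and bij: "bij f"
    and measurable_f: "f \<in> measurable M M"
    and measurable_inv_f: "inv f \<in> measurable M M"
    and RN_deriv_image: "RN_deriv_bounded_below M (distr M M (inv f))"
    and RN_deriv_vimage: "RN_deriv_bounded_below M (distr M M f)"

locale dissipative_system = composition_dynamical_system M f
  for M :: "'a::{second_countable_topology, t2_space} measure" and f :: "'a \<Rightarrow> 'a" +
  fixes W :: "'a set"
  assumes W_sets: "W \<in> sets M"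
    and W_pos: "0 < emeasure M W"
    and W_finite: "emeasure M W < \<infinity>"
    and W_disjoint: "disjoint_family (\<lambda>k. int_iterate f k ` W)"
    and W_cover: "(\<Union>k. int_iterate f k ` W) = UNIV"

locale bounded_distortion_system = dissipative_system M f W
  for M :: "'a::{second_countable_topology, t2_space} measure" and f :: "'a \<Rightarrow> 'a" and W :: "'a set" +
  assumes bounded_distortion:
    "\<exists>K::real. 0 < K \<and>
      (\<forall>k B. B \<in> sets M \<longrightarrow> B \<subseteq> W \<longrightarrow> 0 < emeasure M B \<longrightarrow>
        ennreal (1 / K) * emeasure M (int_iterate f k ` W) * emeasure M B
          \<le> emeasure M (int_iterate f k ` B) * emeasure M W \<and>
        emeasure M (int_iterate f k ` B) * emeasure M W
          \<le> ennreal K * emeasure M (int_iterate f k ` W) * emeasure M B)"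

context composition_dynamical_system
begin

lemma space_eq_UNIV: "space M = UNIV"
  using sets_eq_imp_space_eq[OF sets_eq_borel] by simp

lemma nn_integral_comp_bounded:
  "\<exists>c::real. 0 < c \<and>
    (\<forall>g\<in>borel_measurable M. ennreal c * (\<integral>\<^sup>+x. g (f x) \<partial>M) \<le> (\<integral>\<^sup>+x. g x \<partial>M))"
proof -
  let ?N = "distr M M (inv f)"
  obtain c :: real where c: "0 < c" "AE x in M. ennreal c \<le> RN_deriv M ?N x"
    and dens: "density M (RN_deriv M ?N) = ?N"
    using RN_deriv_image by (auto simp: RN_deriv_bounded_below_def)
  have "ennreal c * (\<integral>\<^sup>+x. g (f x) \<partial>M) \<le> (\<integral>\<^sup>+x. g x \<partial>M)" if g: "g \<in> borel_measurable M" for g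
  proof -
    have gf: "(\<lambda>x. g (f x)) \<in> borel_measurable M"
      using measurable_compose[OF measurable_f g] .
    have "ennreal c * (\<integral>\<^sup>+x. g (f x) \<partial>M) = (\<integral>\<^sup>+x. ennreal c * g (f x) \<partial>M)"
      using gf by (simp add: nn_integral_cmult)
    also have "\<dots> \<le> (\<integral>\<^sup>+x. RN_deriv M ?N x * g (f x) \<partial>M)"
      using c(2) by (intro nn_integral_mono_AE) (auto elim!: eventually_mono intro: mult_right_mono)
    also have "\<dots> = (\<integral>\<^sup>+x. g (f x) \<partial>density M (RN_deriv M ?N))"
      using gf by (simp add: nn_integral_density)
    also have "\<dots> = (\<integral>\<^sup>+x. g (f x) \<partial>?N)"
      by (simp only: dens)
    also have "\<dots> = (\<integral>\<^sup>+x. g (f (inv f x)) \<partial>M)"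
      using gf measurable_inv_f by (simp add: nn_integral_distr)
    also have "\<dots> = (\<integral>\<^sup>+x. g x \<partial>M)"
      using bij by (simp add: bij_is_surj surj_f_inv_f)
    finally show ?thesis .
  qed
  then show ?thesis
    using c(1) by blast
qed

lemma AE_comp:
  assumes "AE x in M. P x"
  shows "AE x in M. P (f x)"
proof -
  obtain N where N: "{x \<in> space M. \<not> P x} \<subseteq> N" "emeasure M N = 0" "N \<in> sets M"
    using assms by (rule AE_E)
  obtain c :: real where c: "0 < c"
    "\<And>g. g \<in> borel_measurable M \<Longrightarrow> ennreal c * (\<integral>\<^sup>+x. g (f x) \<partial>M) \<le> (\<integral>\<^sup>+x. g x \<partial>M)"
    using nn_integral_comp_bounded by blast
  have fN: "f -` N \<in> sets M"
    using measurable_sets[OF measurable_f N(3)] by (simp add: space_eq_UNIV)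
  have "(\<lambda>x. indicator N (f x) :: ennreal) = indicator (f -` N)"
    by (auto simp: indicator_def)
  then have "ennreal c * emeasure M (f -` N) \<le> 0"
    using c(2)[of "indicator N"] N(2,3) fN by simp
  then have "emeasure M (f -` N) = 0"
    using c(1) by simp
  then show ?thesis
    using N(1) fN by (intro AE_I[of _ _ "f -` N"]) (auto simp: space_eq_UNIV)
qed

lemma Lp_fun_comp:
  assumes "\<phi> \<in> Lp_fun M p"
  shows "\<phi> \<circ> f \<in> Lp_fun M p"
proof -
  have [measurable]: "\<phi> \<in> borel_measurable M" "f \<in> measurable M M"
    using assms measurable_f by (auto intro: Lp_fun_measurable)
  let ?g = "\<lambda>x. ennreal (cmod (\<phi> x) powr p)"
  obtain c :: real where c: "0 < c"
    "\<And>g. g \<in> borel_measurable M \<Longrightarrow> ennreal c * (\<integral>\<^sup>+x. g (f x) \<partial>M) \<le> (\<integral>\<^sup>+x. g x \<partial>M)"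
    using nn_integral_comp_bounded by blast
  have "ennreal c * (\<integral>\<^sup>+x. ?g (f x) \<partial>M) \<le> (\<integral>\<^sup>+x. ?g x \<partial>M)"
    by (rule c(2)) simp
  also have "\<dots> < \<infinity>"
    using assms by (simp add: Lp_fun_def integrable_iff_bounded)
  finally have "(\<integral>\<^sup>+x. ?g (f x) \<partial>M) < \<infinity>"
    using c(1) by (auto simp: ennreal_mult_less_top)
  then show ?thesis
    by (simp add: Lp_fun_def integrable_iff_bounded comp_def)
qed

lemma composition_operator_class:
  assumes "\<phi> \<in> Lp_fun M p"
  shows "composition_operator M p f (Lp_rel M p `` {\<phi>}) = Lp_rel M p `` {\<phi> \<circ> f}"
proof -
  have "congruent (Lp_rel M p) (\<lambda>\<phi>. Lp_rel M p `` {\<phi> \<circ> f})"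
  proof (rule congruentI)
    fix \<phi> \<psi>
    assume "(\<phi>, \<psi>) \<in> Lp_rel M p"
    then have *: "\<phi> \<in> Lp_fun M p" "\<psi> \<in> Lp_fun M p" "AE x in M. \<phi> x = \<psi> x"
      by (auto simp: Lp_rel_def)
    have "(\<phi> \<circ> f, \<psi> \<circ> f) \<in> Lp_rel M p"
      using Lp_fun_comp[OF *(1)] Lp_fun_comp[OF *(2)] AE_comp[OF *(3)] by (simp add: Lp_rel_def)
    then show "Lp_rel M p `` {\<phi> \<circ> f} = Lp_rel M p `` {\<psi> \<circ> f}"
      by (rule equiv_class_eq[OF equiv_Lp_rel])
  qed
  then show ?thesis
    using UN_equiv_class[OF equiv_Lp_rel _ assms] by (simp add: composition_operator_def)
qed

end

end

(*
  Write m k for the measure of the k-th iterate of W; boundedness of the Radon-Nikodym derivatives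
  makes m (k + 1) / m k bounded above and below, so the condition is equivalent for all q to
  liminf m (-n) * m n = 0.

  Necessity: bounded distortion lets one compare the p-th power integrals of phi o f^k over W, for
  varying k, with the L^p norm.  Take two points u = a * T^i phi and v = b * T^j phi of the
  projective orbit near the indicator functions of W and of W together with f(W).  Level 0, where
  both are large, corresponds under T^(j-i) to a level of u, and under T^(i-j) to a level of v, at
  which the target vanishes; the unknown scalar b / a cancels in the product of the two resulting
  estimates, which then bounds m (i-j) * m (j-i).  The targets are chosen different so that j - i
  is neither 0 nor -1, where the argument would break down.

  Sufficiency: with y_0, y_1, ... running infinitely often through a countable dense set of bounded
  functions supported on finitely many levels, the supercyclic vector is the sum of c_j * y_j o f^(-n_j)
  with c_j^p = sqrt (m (-n_j) / m n_j) and m (-n_j) * m n_j tending to 0 fast enough.  The supports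
  are pairwise disjoint, so the p-th powers of the norms simply add up and the completeness of L^p
  is not needed.
*)

theory Submission
  imports Defs
begin

section \<open>$p$-th powers of the norm and iterates of the map\<close>


text \<open>The \<open>p\<close>-th power of the norm, without the root: it scales and splits over
  disjoint supports by simple formulas. The price is a factor \<open>2 powr p\<close> in the
  triangle inequality.\<close>

definition Lp_int :: "'a measure \<Rightarrow> real \<Rightarrow> ('a \<Rightarrow> complex) \<Rightarrow> real" where
  "Lp_int M p \<phi> = (\<integral>x. cmod (\<phi> x) powr p \<partial>M)"

lemma Lp_int_nonneg: "0 \<le> Lp_int M p \<phi>"
  by (simp add: Lp_int_def)

lemma Lp_seminorm_less_iff:
  assumes "1 \<le> p" "0 < r"
  shows "Lp_seminorm M p \<phi> < r \<longleftrightarrow> Lp_int M p \<phi> < r powr p"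
proof -
  have "Lp_seminorm M p \<phi> < r \<longleftrightarrow> (Lp_int M p \<phi>) powr (1 / p) < (r powr p) powr (1 / p)"
    using assms by (simp add: Lp_seminorm_def Lp_int_def powr_powr)
  also have "\<dots> \<longleftrightarrow> Lp_int M p \<phi> < r powr p"
    using assms Lp_int_nonneg[of M p \<phi>] powr_less_mono2[of "1/p"] powr_mono2[of "1/p"]
    by (smt (verit) divide_nonneg_nonneg divide_pos_pos powr_ge_zero)
  finally show ?thesis .
qed

lemma Lp_int_scale: "Lp_int M p (\<lambda>x. c * \<phi> x) = cmod c powr p * Lp_int M p \<phi>"
  by (simp add: Lp_int_def norm_mult powr_mult)

text \<open>The modulus of a sum is at most twice the larger modulus, whose \<open>p\<close>-th
  power is one of the two summands on the right.\<close>

lemma powr_cmod_add_le: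
  assumes "1 \<le> p"
  shows "cmod (a + b) powr p \<le> 2 powr p * (cmod a powr p + cmod b powr p)"
proof -
  have "cmod (a + b) powr p \<le> (2 * max (cmod a) (cmod b)) powr p"
    using assms norm_triangle_ineq[of a b] by (intro powr_mono2) auto
  also have "\<dots> = 2 powr p * max (cmod a) (cmod b) powr p"
    by (simp add: powr_mult)
  also have "\<dots> \<le> 2 powr p * (cmod a powr p + cmod b powr p)"
    by (intro mult_left_mono) (auto simp: max_def)
  finally show ?thesis .
qed

lemma Lp_int_add_le:
  assumes "1 \<le> p" "\<phi> \<in> Lp_fun M p" "\<psi> \<in> Lp_fun M p"
  shows "Lp_int M p (\<lambda>x. \<phi> x + \<psi> x) \<le> 2 powr p * (Lp_int M p \<phi> + Lp_int M p \<psi>)"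
proof -
  have [simp]: "integrable M (\<lambda>x. cmod (\<phi> x) powr p)" "integrable M (\<lambda>x. cmod (\<psi> x) powr p)"
    "integrable M (\<lambda>x. cmod (\<phi> x + \<psi> x) powr p)"
    using assms Lp_fun_add[OF assms] by (auto simp: Lp_fun_def)
  have "Lp_int M p (\<lambda>x. \<phi> x + \<psi> x)
      \<le> (\<integral>x. 2 powr p * (cmod (\<phi> x) powr p + cmod (\<psi> x) powr p) \<partial>M)"
    unfolding Lp_int_def using powr_cmod_add_le[OF assms(1)] by (intro integral_mono) auto
  then show ?thesis
    by (simp add: Lp_int_def)
qed

lemma Lp_int_triangle:
  assumes "1 \<le> p" "\<phi> \<in> Lp_fun M p" "\<psi> \<in> Lp_fun M p" "\<theta> \<in> Lp_fun M p"
  shows "Lp_int M p (\<lambda>x. \<phi> x - \<theta> x)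
    \<le> 2 powr p * (Lp_int M p (\<lambda>x. \<phi> x - \<psi> x) + Lp_int M p (\<lambda>x. \<psi> x - \<theta> x))"
  using Lp_int_add_le[OF assms(1) Lp_fun_diff[OF assms(1,2,3)] Lp_fun_diff[OF assms(1,3,4)]]
  by simp

lemma Lp_fun_bound:
  assumes "g \<in> Lp_fun M p" "\<phi> \<in> borel_measurable M" "0 \<le> p" "\<And>x. cmod (\<phi> x) \<le> C * cmod (g x)"
  shows "\<phi> \<in> Lp_fun M p"
proof -
  have *: "cmod (\<phi> x) powr p \<le> cmod (C * g x) powr p" for x
  proof (rule powr_mono2)
    have "cmod (\<phi> x) \<le> C * cmod (g x)" by fact
    also have "\<dots> \<le> \<bar>C\<bar> * cmod (g x)" by (intro mult_right_mono) auto
    finally show "cmod (\<phi> x) \<le> cmod (C * g x)" by (simp add: norm_mult)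
  qed (use assms in auto)
  have "integrable M (\<lambda>x. cmod (C * g x) powr p)"
    using Lp_fun_scale[OF assms(1), of "of_real C"] by (simp add: Lp_fun_def)
  then have "integrable M (\<lambda>x. cmod (\<phi> x) powr p)"
    by (rule Bochner_Integration.integrable_bound) (use assms(2) * in auto)
  then show ?thesis
    using assms by (simp add: Lp_fun_def)
qed

text \<open>Dominated convergence with dominating function \<open>cmod (C * g x) powr p\<close>; it
  serves the two limit passages of the density proof.\<close>

lemma Lp_int_dominated_tendsto_0:
  assumes p: "1 \<le> p" and g: "g \<in> Lp_fun M p" and meas: "\<And>i. s i \<in> borel_measurable M"
    and bound: "\<And>i x. cmod (s i x) \<le> C * cmod (g x)"
    and lim: "\<And>x. x \<in> space M \<Longrightarrow> (\<lambda>i. s i x) \<longlonglongrightarrow> 0"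
  shows "(\<lambda>i. Lp_int M p (s i)) \<longlonglongrightarrow> 0"
proof -
  have bd: "cmod (s i x) powr p \<le> cmod (C * g x) powr p" for i x
  proof (rule powr_mono2)
    have "cmod (s i x) \<le> C * cmod (g x)" by fact
    also have "\<dots> \<le> \<bar>C\<bar> * cmod (g x)" by (intro mult_right_mono) auto
    finally show "cmod (s i x) \<le> cmod (C * g x)" by (simp add: norm_mult)
  qed (use p in auto)
  have "(\<lambda>i. \<integral>x. cmod (s i x) powr p \<partial>M) \<longlonglongrightarrow> (\<integral>x. 0 \<partial>M)"
  proof (rule integral_dominated_convergence)
    show "integrable M (\<lambda>x. cmod (C * g x) powr p)"
      using Lp_fun_scale[OF g, of "of_real C"] by (simp add: Lp_fun_def)
    have "(\<lambda>i. cmod (s i x) powr p) \<longlonglongrightarrow> 0" if x: "x \<in> space M" for x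
      using tendsto_norm_zero[OF lim[OF x]] p
      by (intro tendsto_zero_powrI[where b=p]) auto
    then show "AE x in M. (\<lambda>i. cmod (s i x) powr p) \<longlonglongrightarrow> 0"
      by auto
    show "AE x in M. norm (cmod (s i x) powr p) \<le> cmod (C * g x) powr p" for i
      using bd by auto
  qed (use meas in auto)
  then show ?thesis
    by (simp add: Lp_int_def)
qed

section \<open>Supercyclicity in terms of representatives\<close>

context composition_dynamical_system
begin

lemma composition_operator_funpow_class:
  assumes "\<phi> \<in> Lp_fun M p"
  shows "\<phi> \<circ> (f ^^ n) \<in> Lp_fun M p \<and>
    (composition_operator M p f ^^ n) (Lp_rel M p `` {\<phi>}) = Lp_rel M p `` {\<phi> \<circ> (f ^^ n)}"
proof (induction n)
  case 0
  then show ?case using assms by simp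
next
  case (Suc n)
  then have *: "(\<phi> \<circ> (f ^^ n)) \<circ> f \<in> Lp_fun M p" "composition_operator M p f (Lp_rel M p `` {\<phi> \<circ> (f ^^ n)}) =
    Lp_rel M p `` {(\<phi> \<circ> (f ^^ n)) \<circ> f}"
    using Lp_fun_comp composition_operator_class by blast+
  have eq: "(\<phi> \<circ> (f ^^ n)) \<circ> f = \<phi> \<circ> (f ^^ Suc n)"
    by (simp only: funpow_Suc_right comp_assoc)
  show ?case
    using * Suc.IH unfolding eq by (metis comp_apply funpow.simps(2))
qed

text \<open>A set is dense when it meets every ball. Balls, scalings and iterates are evaluated on
  representatives, and a radius \<open>r\<close> of the metric turns into the bound
  \<open>r powr p\<close> for \<open>Lp_int\<close>.\<close>

lemma supercyclic_iff:
  assumes p: "1 \<le> p"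
  shows "supercyclic (Lp M p) (Lp_dist M p) (Lp_scale M p) (composition_operator M p f) \<longleftrightarrow>
    (\<exists>\<phi>\<in>Lp_fun M p. \<forall>g\<in>Lp_fun M p. \<forall>\<epsilon>>0. \<exists>c n. Lp_int M p (\<lambda>x. c * \<phi> ((f ^^ n) x) - g x) < \<epsilon>)"
    (is "?L \<longleftrightarrow> ?R")
proof -
  interpret Lp: Metric_space "Lp M p" "Lp_dist M p"
    by (rule Metric_space_Lp[OF p])
  let ?S = "\<lambda>A. {Lp_scale M p c ((composition_operator M p f ^^ n) A) | c n. True}"
  let ?cl = "\<lambda>\<phi>. Lp_rel M p `` {\<phi>}"
  have in_Lp: "?cl \<phi> \<in> Lp M p" if "\<phi> \<in> Lp_fun M p" for \<phi>
    using that by (simp add: Lp_def quotientI)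
  have Lp_obtain: "\<exists>\<phi>\<in>Lp_fun M p. A = ?cl \<phi>" if "A \<in> Lp M p" for A
    using that unfolding Lp_def by (elim quotientE) blast
  have dense: "Lp.mtopology closure_of (?S (?cl \<phi>)) = Lp M p \<longleftrightarrow>
      (\<forall>g\<in>Lp_fun M p. \<forall>\<epsilon>>0. \<exists>c n. Lp_int M p (\<lambda>x. c * \<phi> ((f ^^ n) x) - g x) < \<epsilon>)"
    if \<phi>: "\<phi> \<in> Lp_fun M p" for \<phi>
  proof -
    define G where "G c n = (\<lambda>x. c * \<phi> ((f ^^ n) x))" for c n
    have G: "Lp_scale M p c ((composition_operator M p f ^^ n) (?cl \<phi>)) = ?cl (G c n)"
      "G c n \<in> Lp_fun M p" for c n
      using composition_operator_funpow_class[OF \<phi>, of n] Lp_scale_class[of "\<phi> \<circ> (f ^^ n)" M p c]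
        Lp_fun_scale[of "\<phi> \<circ> (f ^^ n)" M p c] by (simp_all add: G_def)
    have ball: "?cl (G c n) \<in> Lp.mball (?cl g) r \<longleftrightarrow> Lp_int M p (\<lambda>x. G c n x - g x) < r powr p"
      if "g \<in> Lp_fun M p" "0 < r" for g r c n
    proof -
      have "Lp_dist M p (?cl g) (?cl (G c n)) = Lp_seminorm M p (\<lambda>x. G c n x - g x)"
        using Lp.commute[of "?cl g" "?cl (G c n)"] Lp_dist_class[OF G(2) that(1)] by simp
      then show ?thesis
        using in_Lp[OF that(1)] in_Lp[OF G(2)] Lp_seminorm_less_iff[OF p that(2)]
        by (simp add: Lp.in_mball)
    qed
    have "Lp.mtopology closure_of (?S (?cl \<phi>)) = Lp M p \<longleftrightarrow>
      (\<forall>A\<in>Lp M p. \<forall>r>0. \<exists>c n. ?cl (G c n) \<in> Lp.mball A r)"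
    proof -
      have "{A \<in> X. P A} = X \<longleftrightarrow> (\<forall>A\<in>X. P A)" for X :: "('a \<Rightarrow> complex) set set" and P
        by auto
      moreover have "(\<exists>B\<in>{?cl (G c n) | c n. True}. Q B) \<longleftrightarrow> (\<exists>c n. Q (?cl (G c n)))" for Q
        by auto
      ultimately show ?thesis
        unfolding Lp.metric_closure_of G(1) by simp
    qed
    also have "\<dots> \<longleftrightarrow> (\<forall>g\<in>Lp_fun M p. \<forall>\<epsilon>>0. \<exists>c n. Lp_int M p (\<lambda>x. G c n x - g x) < \<epsilon>)"
      (is "?L' \<longleftrightarrow> ?R'")
    proof
      assume L: ?L'
      show ?R'
      proof (intro ballI allI impI)
        fix g and \<epsilon> :: real assume g: "g \<in> Lp_fun M p" and \<epsilon>: "0 < \<epsilon>"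
        have pos: "0 < \<epsilon> powr (1/p)" using \<epsilon> by simp
        obtain c n where "?cl (G c n) \<in> Lp.mball (?cl g) (\<epsilon> powr (1/p))"
          using L in_Lp[OF g] pos by blast
        then show "\<exists>c n. Lp_int M p (\<lambda>x. G c n x - g x) < \<epsilon>"
          using ball[OF g pos] p \<epsilon> by (auto simp: powr_powr)
      qed
    next
      assume R: ?R'
      show ?L'
      proof (intro ballI allI impI)
        fix A and r :: real assume A: "A \<in> Lp M p" and r: "0 < r"
        obtain g where g: "g \<in> Lp_fun M p" "A = ?cl g"
          using Lp_obtain[OF A] by blast
        have "0 < r powr p" using r by simp
        then obtain c n where "Lp_int M p (\<lambda>x. G c n x - g x) < r powr p"
          using R g(1) by blast
        then show "\<exists>c n. ?cl (G c n) \<in> Lp.mball A r"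
          using ball[OF g(1) r] g(2) by blast
      qed
    qed
    finally show ?thesis
      by (simp add: G_def)
  qed
  show ?thesis
  proof
    assume ?L
    then obtain A where A: "A \<in> Lp M p" "Lp.mtopology closure_of (?S A) = Lp M p"
      unfolding supercyclic_def by blast
    obtain \<phi> where \<phi>: "\<phi> \<in> Lp_fun M p" "A = ?cl \<phi>"
      using Lp_obtain[OF A(1)] by blast
    show ?R
      using A(2) dense[OF \<phi>(1)] \<phi> by (intro bexI[of _ \<phi>]) simp_all
  next
    assume ?R
    then obtain \<phi> where \<phi>: "\<phi> \<in> Lp_fun M p"
      "\<forall>g\<in>Lp_fun M p. \<forall>\<epsilon>>0. \<exists>c n. Lp_int M p (\<lambda>x. c * \<phi> ((f ^^ n) x) - g x) < \<epsilon>"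
      by blast
    show ?L
      unfolding supercyclic_def using dense[OF \<phi>(1)] \<phi>(2) in_Lp[OF \<phi>(1)]
      by (intro bexI[of _ "?cl \<phi>"]) simp_all
  qed
qed

section \<open>Integer iterates of \<open>f\<close> and the change of measure in one step\<close>

lemma int_iterate_0 [simp]: "int_iterate f 0 x = x"
  by (simp add: int_iterate_def)

lemma int_iterate_of_nat: "int_iterate f (int n) = f ^^ n"
  by (simp add: int_iterate_def)

lemma int_iterate_plus1: "int_iterate f (k + 1) x = f (int_iterate f k x)"
proof (cases "0 \<le> k")
  case True
  then show ?thesis
    by (simp add: int_iterate_def nat_add_distrib)
next
  case False
  then obtain n where n: "k = - int (Suc n)"
    by (metis int_cases linorder_not_le of_nat_0_le_iff)
  have "f ((inv f ^^ Suc n) x) = (inv f ^^ n) x"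
    using bij by (simp add: bij_is_surj surj_f_inv_f)
  \<comment> \<open>For \<open>n = 0\<close> the index \<open>k + 1\<close> is 0 and falls into the
    nonnegative branch of \<open>int_iterate\<close>, hence the split on \<open>n\<close>.\<close>
  then show ?thesis
    unfolding n by (cases n) (auto simp: int_iterate_def nat_add_distrib)
qed

lemma int_iterate_add: "int_iterate f (j + k) x = int_iterate f j (int_iterate f k x)"
proof (induction j rule: int_induct[where k = 0])
  case base
  then show ?case by simp
next
  case (step1 i)
  then show ?case
    using int_iterate_plus1[of "i + k" x] int_iterate_plus1[of i "int_iterate f k x"] by (simp add: algebra_simps)
next
  case (step2 i)
  \<comment> \<open>Applying \<open>f\<close> to both sides leads back to the induction hypothesis;
    injectivity then removes \<open>f\<close>.\<close>
  then have "f (int_iterate f (i - 1 + k) x) = f (int_iterate f (i - 1) (int_iterate f k x))"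
    using int_iterate_plus1[of "i - 1 + k" x] int_iterate_plus1[of "i - 1" "int_iterate f k x"]
    by (simp add: algebra_simps)
  then show ?case
    using bij by (simp add: bij_is_inj inj_eq)
qed

lemma int_iterate_minus [simp]: "int_iterate f (- k) (int_iterate f k x) = x"
  "int_iterate f k (int_iterate f (- k) x) = x"
  using int_iterate_add[of "- k" k x] int_iterate_add[of k "- k" x] by simp_all

lemma int_iterate_measurable [measurable]: "int_iterate f k \<in> measurable M M"
  using measurable_f measurable_inv_f by (auto simp: int_iterate_def intro: measurable_compose_n)

text \<open>Writing images as preimages under the opposite iterate makes the rules for measurable
  maps and push-forwards applicable.\<close>

lemma image_int_iterate: "int_iterate f k ` A = int_iterate f (- k) -` A"
  by (auto simp: image_iff) (metis int_iterate_minus(2))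

text \<open>The hypotheses are symmetric in \<open>f\<close> and \<open>inv f\<close>; the two
  Radon-Nikodym conditions trade places. Estimates for \<open>f\<close> thus carry over to the
  inverse.\<close>

lemma composition_dynamical_system_inv: "composition_dynamical_system M (inv f)"
  using locally_compact sigma_compact sets_eq_borel locally_finite bij measurable_f measurable_inv_f
    RN_deriv_image RN_deriv_vimage
  by unfold_locales (auto simp: inv_inv_eq bij_imp_bij_inv)

lemma Lp_fun_int_iterate:
  assumes "\<phi> \<in> Lp_fun M p"
  shows "(\<lambda>x. \<phi> (int_iterate f k x)) \<in> Lp_fun M p"
proof -
  interpret inv: composition_dynamical_system M "inv f"
    by (rule composition_dynamical_system_inv)
  show ?thesis
    using composition_operator_funpow_class[OF assms] inv.composition_operator_funpow_class[OF assms]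
    by (auto simp: int_iterate_def comp_def)
qed

text \<open>The integral bounds for \<open>f\<close> and for \<open>inv f\<close>, tested on
  indicator functions, give one inequality each.\<close>

lemma emeasure_image_bounded:
  obtains C :: real where "1 \<le> C"
    "\<And>A. A \<in> sets M \<Longrightarrow> emeasure M (f ` A) \<le> ennreal C * emeasure M A"
    "\<And>A. A \<in> sets M \<Longrightarrow> emeasure M A \<le> ennreal C * emeasure M (f ` A)"
proof -
  interpret inv: composition_dynamical_system M "inv f"
    by (rule composition_dynamical_system_inv)
  have inv_image: "inv f -` A = f ` A" for A
    using bij by (simp add: bij_vimage_eq_inv_image inv_inv_eq bij_imp_bij_inv)
  have vim: "f -` (f ` A) = A" for A
    using bij by (simp add: bij_is_inj inj_vimage_image_eq)
  obtain c where c: "0 < c"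
    "\<And>g. g \<in> borel_measurable M \<Longrightarrow> ennreal c * (\<integral>\<^sup>+x. g (f x) \<partial>M) \<le> (\<integral>\<^sup>+x. g x \<partial>M)"
    using nn_integral_comp_bounded by blast
  obtain d where d: "0 < d"
    "\<And>g. g \<in> borel_measurable M \<Longrightarrow> ennreal d * (\<integral>\<^sup>+x. g (inv f x) \<partial>M) \<le> (\<integral>\<^sup>+x. g x \<partial>M)"
    using inv.nn_integral_comp_bounded by blast
  have sets: "f ` A \<in> sets M" if "A \<in> sets M" for A
    using measurable_sets[OF measurable_inv_f that] by (simp add: space_eq_UNIV inv_image)
  have ind1: "(\<lambda>x. indicator (f ` A) (f x) :: ennreal) = indicator A" for A
    using bij by (auto simp: indicator_def fun_eq_iff bij_is_inj inj_image_mem_iff)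
  have ind2: "(\<lambda>x. indicator A (inv f x) :: ennreal) = indicator (f ` A)" for A
    by (auto simp: indicator_def fun_eq_iff simp flip: inv_image)
  have le1: "ennreal c * emeasure M A \<le> emeasure M (f ` A)" if "A \<in> sets M" for A
    using c(2)[of "indicator (f ` A)"] sets[OF that] that by (simp add: ind1)
  have le2: "ennreal d * emeasure M (f ` A) \<le> emeasure M A" if "A \<in> sets M" for A
    using d(2)[of "indicator A"] sets[OF that] that by (simp add: ind2)
  have move: "a \<le> ennreal C * b" if "ennreal e * a \<le> b" "0 < e" "1 / e \<le> C" for a b :: ennreal and e C :: real
  proof -
    have "a = ennreal (1 / e) * (ennreal e * a)"
      using that by (simp add: mult.assoc[symmetric] ennreal_mult[symmetric])
    also have "\<dots> \<le> ennreal C * b"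
      using that by (intro mult_mono) (auto intro!: ennreal_leI)
    finally show ?thesis .
  qed
  show ?thesis
  proof
    show "1 \<le> max 1 (max (1/c) (1/d))" by simp
  qed (use le1 le2 c(1) d(1) in \<open>auto intro!: move\<close>)
qed

end

section \<open>Levels and their measures\<close>


context dissipative_system
begin

text \<open>Since \<open>measure\<close> sends infinite values to 0, agreement with
  \<open>emeasure\<close> has to be proved; this is \<open>emeasure_level\<close>.\<close>

definition wandering_measure :: "int \<Rightarrow> real" where
  "wandering_measure k = measure M (int_iterate f k ` W)"

text \<open>\<open>THE\<close> is justified because the iterates of \<open>W\<close> partition the
  space. With \<open>level\<close>, statements about these sets become integer arithmetic:
  \<open>f\<close> adds 1.\<close>

definition level :: "'a \<Rightarrow> int" where
  "level x = (THE k. x \<in> int_iterate f k ` W)"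

lemma level_iff: "x \<in> int_iterate f k ` W \<longleftrightarrow> level x = k"
proof -
  obtain j where j: "x \<in> int_iterate f j ` W"
    using W_cover by blast
  have uniq: "i = j" if "x \<in> int_iterate f i ` W" for i
    using W_disjoint that j unfolding disjoint_family_on_def by blast
  have "level x = j"
    unfolding level_def using j uniq by (rule the_equality)
  then show ?thesis
    using j uniq by metis
qed

lemma level_int_iterate: "level (int_iterate f n x) = level x + n"
proof -
  obtain w where w: "w \<in> W" "x = int_iterate f (level x) w"
    using level_iff[of x "level x"] by auto
  have "int_iterate f n x = int_iterate f (level x + n) w"
    using int_iterate_add[of n "level x" w] w(2) by (simp add: add.commute)
  then have "int_iterate f n x \<in> int_iterate f (level x + n) ` W"
    using w(1) by simp
  then show ?thesis
    by (simp add: level_iff)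
qed

lemma image_W_eq: "int_iterate f k ` W = {x. level x = k}"
  by (intro set_eqI) (simp only: level_iff mem_Collect_eq)

text \<open>As a rewrite rule this loops, because \<open>level\<close> depends on \<open>W\<close>.\<close>
lemma W_eq: "W = {x. level x = 0}"
  by (simp add: image_def flip: image_W_eq)

lemma sets_level: "{x. level x = k} \<in> sets M"
proof -
  have "int_iterate f (- k) -` W \<in> sets M"
    using measurable_sets[OF int_iterate_measurable W_sets, of "- k"] by (simp add: space_eq_UNIV)
  then show ?thesis
    by (simp only: image_W_eq[symmetric] image_int_iterate)
qed

lemma image_level: "f ` {x. level x = k} = {x. level x = k + 1}"
proof -
  have "f ` (int_iterate f k ` W) = int_iterate f (k + 1) ` W"
    by (simp add: image_image int_iterate_plus1)
  then show ?thesis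
    by (simp add: image_W_eq)
qed

lemma emeasure_level_bounded:
  obtains C :: real where "1 \<le> C"
    "\<And>k. emeasure M {x. level x = k + 1} \<le> ennreal C * emeasure M {x. level x = k}"
    "\<And>k. emeasure M {x. level x = k} \<le> ennreal C * emeasure M {x. level x = k + 1}"
proof -
  obtain C :: real where "1 \<le> C"
    "\<And>A. A \<in> sets M \<Longrightarrow> emeasure M (f ` A) \<le> ennreal C * emeasure M A"
    "\<And>A. A \<in> sets M \<Longrightarrow> emeasure M A \<le> ennreal C * emeasure M (f ` A)"
    using emeasure_image_bounded by blast
  then show ?thesis
    using sets_level that[of C] by (simp flip: image_level)
qed

text \<open>Induction in both directions from \<open>W\<close>: of the two bounds between
  neighbouring levels, one passes on finiteness and the other positivity.\<close>

lemma emeasure_level_finite_pos: "emeasure M {x. level x = k} < \<infinity> \<and> 0 < emeasure M {x. level x = k}"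
proof -
  obtain C :: real where C: "1 \<le> C"
    "\<And>k. emeasure M {x. level x = k + 1} \<le> ennreal C * emeasure M {x. level x = k}"
    "\<And>k. emeasure M {x. level x = k} \<le> ennreal C * emeasure M {x. level x = k + 1}"
    using emeasure_level_bounded by blast
  have fin: "a < \<infinity>" if "a \<le> ennreal C * b" "b < \<infinity>" for a b
    using le_less_trans[OF that(1)] that(2) by (simp add: ennreal_mult_less_top)
  have pos: "0 < b" if "a \<le> ennreal C * b" "0 < a" for a b :: ennreal
    using less_le_trans[OF that(2,1)] by (simp add: zero_less_iff_neq_zero)
  show ?thesis
  proof (induction k rule: int_induct[where k = 0])
    case base
    then show ?case using W_finite W_pos by (simp flip: W_eq)
  next
    case (step1 i)
    then show ?case
      using fin[OF C(2)[of i]] pos[OF C(3)[of i]] by simp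
  next
    case (step2 i)
    then show ?case
      using fin[OF C(3)[of "i - 1"]] pos[OF C(2)[of "i - 1"]] by simp
  qed
qed

lemma emeasure_level: "emeasure M {x. level x = k} = ennreal (wandering_measure k)"
  using emeasure_level_finite_pos[of k]
  by (simp add: wandering_measure_def image_W_eq emeasure_eq_ennreal_measure less_top)

lemma wandering_measure_pos: "0 < wandering_measure k"
  using emeasure_level_finite_pos[of k] by (simp add: emeasure_level)

text \<open>Neighbouring levels have comparable measures, and this is iterated
  \<open>\<bar>j\<bar>\<close> times. The bound absorbs the shift by \<open>q\<close> in the
  criterion and the spread of a function over several levels.\<close>

lemma wandering_measure_ratio:
  obtains C :: real where "1 \<le> C" "\<And>j k. wandering_measure (k + j) \<le> C ^ nat \<bar>j\<bar> * wandering_measure k"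
proof -
  obtain C :: real where C: "1 \<le> C"
    "\<And>k. emeasure M {x. level x = k + 1} \<le> ennreal C * emeasure M {x. level x = k}"
    "\<And>k. emeasure M {x. level x = k} \<le> ennreal C * emeasure M {x. level x = k + 1}"
    using emeasure_level_bounded by blast
  have up: "wandering_measure (k + 1) \<le> C * wandering_measure k" 
    and down: "wandering_measure k \<le> C * wandering_measure (k + 1)" for k
    using C(2,3)[of k] C(1) wandering_measure_pos[of k] wandering_measure_pos[of "k+1"]
    by (simp_all add: emeasure_level flip: ennreal_mult)
  have "wandering_measure (k + int n) \<le> C ^ n * wandering_measure k" for k n
  proof (induction n)
    case (Suc n)
    have "wandering_measure (k + int (Suc n)) \<le> C * wandering_measure (k + int n)"
      using up[of "k + int n"] by (simp add: algebra_simps)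
    also have "\<dots> \<le> C * (C ^ n * wandering_measure k)"
      using C(1) Suc by (intro mult_left_mono) auto
    finally show ?case by simp
  qed simp
  moreover have "wandering_measure (k - int n) \<le> C ^ n * wandering_measure k" for k n
  proof (induction n)
    case (Suc n)
    have "wandering_measure (k - int (Suc n)) \<le> C * wandering_measure (k - int n)"
      using down[of "k - int (Suc n)"] by (simp add: algebra_simps)
    also have "\<dots> \<le> C * (C ^ n * wandering_measure k)"
      using C(1) Suc by (intro mult_left_mono) auto
    finally show ?case by simp
  qed simp
  ultimately have "wandering_measure (k + j) \<le> C ^ nat \<bar>j\<bar> * wandering_measure k" for j k
    by (cases j rule: int_cases2) simp_all
  with C(1) show ?thesis using that by blast
qed

text \<open>Shifting both indices by \<open>q\<close> changes the product at most by a factor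
  \<open>C ^ (2 * q)\<close> in either direction, so every \<open>q\<close> gives the same condition
  as \<open>q = 0\<close>. For nonnegative terms, a vanishing liminf means that values below each
  \<open>\<epsilon>\<close> occur arbitrarily late.\<close>

lemma liminf_wandering_iff:
  "(\<forall>q::nat. 1 \<le> q \<longrightarrow>
      liminf (\<lambda>n. emeasure M (int_iterate f (int q - int n) ` W)
        * emeasure M (int_iterate f (int q + int n) ` W)) = 0) \<longleftrightarrow>
    (\<forall>\<epsilon>>0. \<forall>N. \<exists>n\<ge>N. wandering_measure (- int n) * wandering_measure (int n) < \<epsilon>)"
    (is "?L \<longleftrightarrow> ?R")
proof -
  have liminf_iff: "liminf (\<lambda>n. ennreal (g n)) = 0 \<longleftrightarrow> (\<forall>\<epsilon>>0. \<forall>N. \<exists>n\<ge>N. g n < \<epsilon>)"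
    for g :: "nat \<Rightarrow> real"
  proof
    assume L: "liminf (\<lambda>n. ennreal (g n)) = 0"
    show "\<forall>\<epsilon>>0. \<forall>N. \<exists>n\<ge>N. g n < \<epsilon>"
    proof (rule ccontr)
      assume "\<not> ?thesis"
      then obtain \<epsilon> N where \<epsilon>: "\<epsilon> > 0" "\<And>n. n \<ge> N \<Longrightarrow> \<epsilon> \<le> g n"
        by (meson linorder_not_less)
      have "ennreal \<epsilon> \<le> liminf (\<lambda>n. ennreal (g n))"
        using \<epsilon>(2) by (intro Liminf_bounded eventually_sequentiallyI[of N] ennreal_leI)
      then show False
        using L \<epsilon>(1) by simp
    qed
  next
    assume R: "\<forall>\<epsilon>>0. \<forall>N. \<exists>n\<ge>N. g n < \<epsilon>"
    show "liminf (\<lambda>n. ennreal (g n)) = 0"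
    proof (rule ccontr)
      assume "\<not> ?thesis"
      then obtain y where y: "0 < y" "y < liminf (\<lambda>n. ennreal (g n))"
        using dense[of 0 "liminf (\<lambda>n. ennreal (g n))"] by (auto simp: zero_less_iff_neq_zero)
      obtain N where N: "\<And>n. n \<ge> N \<Longrightarrow> y < ennreal (g n)"
        using less_LiminfD[OF y(2)] by (auto simp: eventually_sequentially)
      \<comment> \<open>\<open>y\<close> is finite because it lies below the finite value
        \<open>ennreal (g N)\<close>.\<close>
      obtain r where r: "y = ennreal r" "0 < r"
        using y(1) N[of N] by (cases y) auto
      show False
        using R r(2) N unfolding r(1) by (metis ennreal_leI linorder_not_less order_less_imp_le)
    qed
  qed
  let ?m = wandering_measure
  obtain C :: real where C: "1 \<le> C" "\<And>j k. ?m (k + j) \<le> C ^ nat \<bar>j\<bar> * ?m k"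
    using wandering_measure_ratio by blast
  have L: "?L \<longleftrightarrow> (\<forall>q::nat. 1 \<le> q \<longrightarrow> (\<forall>\<epsilon>>0. \<forall>N. \<exists>n\<ge>N. ?m (int q - int n) * ?m (int q + int n) < \<epsilon>))"
    using less_imp_le[OF wandering_measure_pos]
    by (simp add: image_W_eq emeasure_level liminf_iff flip: ennreal_mult)
  have shift: "?m (i + q) * ?m (j + q) \<le> C ^ (2 * nat \<bar>q\<bar>) * (?m i * ?m j)" for i j q
  proof -
    have "?m (i + q) * ?m (j + q) \<le> (C ^ nat \<bar>q\<bar> * ?m i) * (C ^ nat \<bar>q\<bar> * ?m j)"
      using C less_imp_le[OF wandering_measure_pos] by (intro mult_mono) auto
    also have "\<dots> = (C ^ nat \<bar>q\<bar> * C ^ nat \<bar>q\<bar>) * (?m i * ?m j)"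
      by (simp only: mult_ac)
    finally show ?thesis
      by (simp add: mult_2 power_add)
  qed
  show ?thesis
  proof
    assume ?L
    show ?R
    proof (intro allI impI)
      fix \<epsilon> :: real and N assume "\<epsilon> > 0"
      \<comment> \<open>The case \<open>q = 1\<close> suffices; shifting both indices back by 1
        costs \<open>C ^ 2\<close>.\<close>
      then have "0 < \<epsilon> / C ^ 2" using C by simp
      then obtain n where n: "n \<ge> N" "?m (int 1 - int n) * ?m (int 1 + int n) < \<epsilon> / C ^ 2"
        using \<open>?L\<close>[unfolded L] by blast
      have "?m (- int n) * ?m (int n) \<le> C ^ 2 * (?m (int 1 - int n) * ?m (int 1 + int n))"
        using shift[of "1 - int n" "-1" "1 + int n"] by (simp add: power2_eq_square)
      also have "\<dots> < \<epsilon>"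
        using n(2) C(1) by (simp add: field_simps)
      finally show "\<exists>n\<ge>N. ?m (- int n) * ?m (int n) < \<epsilon>"
        using n(1) by blast
    qed
  next
    assume R: ?R
    show ?L
      unfolding L
    proof (intro allI impI)
      fix q N :: nat and \<epsilon> :: real assume "\<epsilon> > 0"
      then have "0 < \<epsilon> / C ^ (2 * q)" using C by simp
      then obtain n where n: "n \<ge> N" "?m (- int n) * ?m (int n) < \<epsilon> / C ^ (2 * q)"
        using R by blast
      have "?m (int q - int n) * ?m (int q + int n) \<le> C ^ (2 * q) * (?m (- int n) * ?m (int n))"
        using shift[of "- int n" "int q" "int n"] by (simp add: add.commute)
      also have "\<dots> < \<epsilon>"
        using n(2) C(1) by (simp add: field_simps)
      finally show "\<exists>n\<ge>N. ?m (int q - int n) * ?m (int q + int n) < \<epsilon>"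
        using n(1) by blast
    qed
  qed
qed

end

section \<open>Necessity\<close>


context dissipative_system
begin

lemma W_iff: "x \<in> W \<longleftrightarrow> level x = 0"
  using level_iff[of x 0] by simp

text \<open>The part of \<open>\<phi>\<close> on level \<open>k\<close>, transported to
  \<open>W\<close> before integrating. In this form composition with an iterate is an exact shift of
  \<open>k\<close>, so orbit points can be compared without loss.\<close>

definition fibre_int :: "real \<Rightarrow> int \<Rightarrow> ('a \<Rightarrow> complex) \<Rightarrow> real" where
  "fibre_int p k \<phi> = Lp_int M p (\<lambda>x. indicator W x * \<phi> (int_iterate f k x))"

lemma fibre_int_nonneg: "0 \<le> fibre_int p k \<phi>"
  by (simp add: fibre_int_def Lp_int_nonneg)

lemma fibre_int_scale: "fibre_int p k (\<lambda>x. c * \<phi> x) = cmod c powr p * fibre_int p k \<phi>"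
  unfolding fibre_int_def using Lp_int_scale[of M p c]
  by (simp add: mult.left_commute[of _ c])

lemma fibre_int_comp: "fibre_int p k (\<lambda>x. \<phi> (int_iterate f j x)) = fibre_int p (j + k) \<phi>"
  by (simp add: fibre_int_def int_iterate_add)

lemma Lp_fun_indicator_mult:
  assumes "\<phi> \<in> Lp_fun M p" "A \<in> sets M" "1 \<le> p"
  shows "(\<lambda>x. indicator A x * \<phi> x) \<in> Lp_fun M p"
proof (rule Lp_fun_bound[OF assms(1)])
  show "(\<lambda>x. indicator A x * \<phi> x) \<in> borel_measurable M"
    using Lp_fun_measurable[OF assms(1)] assms(2) by measurable
  show "cmod (indicator A x * \<phi> x) \<le> 1 * cmod (\<phi> x)" for x
    by (simp add: indicator_def)
qed (use assms in auto)

lemma fibre_int_add_le: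
  assumes "1 \<le> p" "\<phi> \<in> Lp_fun M p" "\<psi> \<in> Lp_fun M p"
  shows "fibre_int p k (\<lambda>x. \<phi> x + \<psi> x) \<le> 2 powr p * (fibre_int p k \<phi> + fibre_int p k \<psi>)"
  using Lp_int_add_le[OF assms(1) Lp_fun_indicator_mult[OF Lp_fun_int_iterate[OF assms(2), of k] W_sets assms(1)]
      Lp_fun_indicator_mult[OF Lp_fun_int_iterate[OF assms(3), of k] W_sets assms(1)]]
  by (simp add: fibre_int_def algebra_simps)

lemma indicator_level_Lp_fun: "indicator {x. level x = j} \<in> Lp_fun M p"
proof -
  have "cmod (indicator {x. level x = j} x) powr p = indicator {x. level x = j} x" for x
    by (simp add: indicator_def)
  then show ?thesis
    using sets_level emeasure_level_finite_pos by (simp add: Lp_fun_def integrable_indicator_iff space_eq_UNIV)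
qed

lemma fibre_int_indicator_level:
  "fibre_int p k (indicator {x. level x = j}) = (if j = k then wandering_measure 0 else 0)"
proof -
  have eq: "indicator W x * indicator {x. level x = j} (int_iterate f k x)
      = (if j = k then indicator W x else 0 :: complex)" for x
    by (simp add: W_iff level_int_iterate indicator_def)
  have "cmod (indicator W x) powr p = indicator W x" for x
    by (simp add: indicator_def)
  then show ?thesis
    unfolding fibre_int_def Lp_int_def eq using W_sets image_W_eq[of 0]
    by (simp add: wandering_measure_def space_eq_UNIV flip: W_eq)
qed

end

section \<open>Consequences of bounded distortion\<close>

context bounded_distortion_system
begin

text \<open>The lower distortion inequality divided by the measure of \<open>W\<close>, which enters
  the new constant. Null sets \<open>B\<close> satisfy it trivially.\<close>

lemma emeasure_image_distortion:
  obtains K :: real where "0 < K"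
    "\<And>k B. B \<in> sets M \<Longrightarrow> B \<subseteq> W \<Longrightarrow>
      ennreal (wandering_measure k / K) * emeasure M B \<le> emeasure M (int_iterate f k ` B)"
proof -
  obtain K :: real where K: "0 < K" "\<And>k B. B \<in> sets M \<Longrightarrow> B \<subseteq> W \<Longrightarrow> 0 < emeasure M B \<Longrightarrow>
      ennreal (1 / K) * emeasure M (int_iterate f k ` W) * emeasure M B
        \<le> emeasure M (int_iterate f k ` B) * emeasure M W"
    using bounded_distortion by (elim exE conjE) simp
  let ?w = "wandering_measure 0"
  have w: "emeasure M W = ennreal ?w" "0 < ?w"
    using emeasure_level[of 0] wandering_measure_pos[of 0] by (simp_all flip: W_eq)
  have "ennreal (wandering_measure k / (K * ?w)) * emeasure M B \<le> emeasure M (int_iterate f k ` B)"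
    if B: "B \<in> sets M" "B \<subseteq> W" for k B
  proof (cases "emeasure M B = 0")
    case False
    have "emeasure M (int_iterate f k ` B) \<le> emeasure M (int_iterate f k ` W)"
      using B(2) sets_level by (intro emeasure_mono) (auto simp: image_W_eq[symmetric])
    then have fin: "emeasure M (int_iterate f k ` B) < \<infinity>"
      using emeasure_level_finite_pos[of k] by (auto simp: image_W_eq)
    have finB: "emeasure M B < \<infinity>"
      using emeasure_mono[OF B(2) W_sets] W_finite by auto
    obtain b where b: "emeasure M B = ennreal b" "0 \<le> b"
      using finB by (cases "emeasure M B") auto
    obtain c where c: "emeasure M (int_iterate f k ` B) = ennreal c" "0 \<le> c"
      using fin by (cases "emeasure M (int_iterate f k ` B)") auto
    have "1 / K * wandering_measure k * b \<le> c * ?w"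
      using K(2)[OF B, of k] K(1) False b c w less_imp_le[OF wandering_measure_pos[of k]]
      by (simp add: image_W_eq emeasure_level zero_less_iff_neq_zero flip: ennreal_mult)
    then have "wandering_measure k / (K * ?w) * b \<le> c"
      using K(1) w(2) by (simp add: field_simps)
    then show ?thesis
      using K(1) w(2) b c less_imp_le[OF wandering_measure_pos[of k]] by (simp flip: ennreal_mult)
  qed simp
  then show ?thesis
    using that[of "K * ?w"] K(1) w(2) by simp
qed

text \<open>The estimate for subsets of \<open>W\<close> is an inequality between two measures: a
  multiple of the restriction to \<open>W\<close>, and the push-forward under the
  \<open>(- k)\<close>-th iterate. Integrating the \<open>p\<close>-th power of
  \<open>\<phi>\<close>, composed with the \<open>k\<close>-th iterate, against both gives the
  claim.\<close>

lemma fibre_int_le: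
  obtains K :: real where "0 < K"
    "\<And>k p \<phi>. \<phi> \<in> Lp_fun M p \<Longrightarrow> 1 \<le> p \<Longrightarrow> wandering_measure k * fibre_int p k \<phi> \<le> K * Lp_int M p \<phi>"
proof -
  obtain K where K: "0 < K" "\<And>k B. B \<in> sets M \<Longrightarrow> B \<subseteq> W \<Longrightarrow>
      ennreal (wandering_measure k / K) * emeasure M B \<le> emeasure M (int_iterate f k ` B)"
    using emeasure_image_distortion by blast
  have "wandering_measure k * fibre_int p k \<phi> \<le> K * Lp_int M p \<phi>"
    if \<phi>: "\<phi> \<in> Lp_fun M p" and p: "1 \<le> p" for k p \<phi>
  proof -
    let ?a = "wandering_measure k / K"
    let ?D = "density M (\<lambda>x. ennreal ?a * indicator W x)"
    let ?N = "distr M M (int_iterate f (- k))"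
    let ?h = "\<lambda>x. ennreal (cmod (\<phi> x) powr p)"
    have a: "0 \<le> ?a"
      using K(1) wandering_measure_pos[of k] by simp
    have [measurable]: "\<phi> \<in> borel_measurable M" "W \<in> sets M"
      using Lp_fun_measurable[OF \<phi>] W_sets by auto
    have le: "?D \<le> ?N"
    proof (rule le_measure[THEN iffD2])
      show "\<forall>A\<in>sets ?D. emeasure ?D A \<le> emeasure ?N A"
      proof
        fix A assume "A \<in> sets ?D"
        then have A: "A \<in> sets M" by simp
        have "emeasure ?D A = (\<integral>\<^sup>+x. ennreal ?a * indicator (A \<inter> W) x \<partial>M)"
          using A by (simp add: emeasure_density indicator_inter_arith mult_ac)
        also have "\<dots> = ennreal ?a * emeasure M (A \<inter> W)"
          using A by (simp add: nn_integral_cmult_indicator)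
        also have "\<dots> \<le> emeasure M (int_iterate f k ` (A \<inter> W))"
          using A K(2) by simp
        also have "\<dots> \<le> emeasure M (int_iterate f k ` A)"
          using measurable_sets[OF int_iterate_measurable A]
          by (intro emeasure_mono) (auto simp: image_int_iterate space_eq_UNIV)
        also have "\<dots> = emeasure ?N A"
          using A by (simp add: emeasure_distr image_int_iterate space_eq_UNIV)
        finally show "emeasure ?D A \<le> emeasure ?N A" .
      qed
    qed simp
    have "ennreal ?a * (\<integral>\<^sup>+x. indicator W x * ?h (int_iterate f k x) \<partial>M) = (\<integral>\<^sup>+x. ?h (int_iterate f k x) \<partial>?D)"
      by (simp add: nn_integral_density nn_integral_cmult mult.assoc)
    also have "\<dots> \<le> (\<integral>\<^sup>+x. ?h (int_iterate f k x) \<partial>?N)"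
      by (rule nn_integral_mono_measure[OF _ le]) simp
    \<comment> \<open>The push-forward cancels the iterate inside \<open>?h\<close>.\<close>
    also have "\<dots> = (\<integral>\<^sup>+x. ?h x \<partial>M)"
      by (simp add: nn_integral_distr)
    also have "\<dots> = ennreal (Lp_int M p \<phi>)"
      using \<phi> by (simp add: Lp_int_def Lp_fun_def nn_integral_eq_integral)
    finally have *: "ennreal ?a * (\<integral>\<^sup>+x. indicator W x * ?h (int_iterate f k x) \<partial>M) \<le> ennreal (Lp_int M p \<phi>)" .
    have "(\<lambda>x. indicator W x * ?h (int_iterate f k x))
        = (\<lambda>x. ennreal (cmod (indicator W x * \<phi> (int_iterate f k x)) powr p))"
      by (auto simp: indicator_def)
    then have "(\<integral>\<^sup>+x. indicator W x * ?h (int_iterate f k x) \<partial>M) = ennreal (fibre_int p k \<phi>)"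
      using Lp_fun_indicator_mult[OF Lp_fun_int_iterate[OF \<phi>, of k] W_sets p]
      by (simp add: fibre_int_def Lp_int_def Lp_fun_def nn_integral_eq_integral)
    then have "?a * fibre_int p k \<phi> \<le> Lp_int M p \<phi>"
      using * a fibre_int_nonneg Lp_int_nonneg[of M p \<phi>] by (simp flip: ennreal_mult)
    then show ?thesis
      using K(1) by (simp add: field_simps)
  qed
  then show ?thesis
    using that K(1) by blast
qed

text \<open>Density is applied to two targets only, supported on the levels 0 and 1. A single index
  \<open>n\<close> is enough here; large indices are obtained afterwards by shrinking
  \<open>\<epsilon>\<close>.\<close>

lemma supercyclic_imp_wandering_small:
  assumes p: "1 \<le> p" and \<phi>: "\<phi> \<in> Lp_fun M p"
    and dense: "\<And>g \<epsilon>. g \<in> Lp_fun M p \<Longrightarrow> 0 < \<epsilon> \<Longrightarrow> \<exists>c n. Lp_int M p (\<lambda>x. c * \<phi> ((f ^^ n) x) - g x) < \<epsilon>"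
    and "0 < \<epsilon>"
  shows "\<exists>n. wandering_measure (- int n) * wandering_measure (int n) < \<epsilon>"
proof -
  let ?m = wandering_measure and ?A = "fibre_int p"
  let ?e = "\<lambda>j. indicator {x. level x = j} :: 'a \<Rightarrow> complex"
  obtain K where K: "0 < K" "\<And>k \<phi>. \<phi> \<in> Lp_fun M p \<Longrightarrow> ?m k * ?A k \<phi> \<le> K * Lp_int M p \<phi>"
    using fibre_int_le p by metis
  define w where "w = ?m 0"
  define b where "b = (2::real) powr p"
  have w: "0 < w" and b: "2 \<le> b"
    using wandering_measure_pos[of 0] powr_mono[of 1 p 2] p by (simp_all add: w_def b_def)
  \<comment> \<open>Only on the levels -1, 0 and 1 must the fibre error itself be small. Dividing
    \<open>K * \<delta>\<close> by \<open>\<mu>\<close> gives a common bound there.\<close>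
  define \<mu> where "\<mu> = Min {?m (-1), ?m 0, ?m 1}"
  have \<mu>: "0 < \<mu>" "\<mu> \<le> ?m (-1)" "\<mu> \<le> ?m 0" "\<mu> \<le> ?m 1"
    using wandering_measure_pos by (auto simp: \<mu>_def)
  \<comment> \<open>The first entry gives
    \<open>K * \<delta> < w / (2 * b) * sqrt \<epsilon>\<close>, needed in the last estimate. The
    second makes the fibre error on the levels -1, 0 and 1 at most
    \<open>w / (8 * b ^ 4)\<close>.\<close>
  define \<delta> where "\<delta> = min (sqrt \<epsilon> * w / (2 * b * K) / 2) (\<mu> * w / (8 * b ^ 4 * K))"
  have \<delta>: "0 < \<delta>" "\<delta> \<le> sqrt \<epsilon> * w / (2 * b * K) / 2" "\<delta> \<le> \<mu> * w / (8 * b ^ 4 * K)"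
    using w b K(1) \<mu>(1) \<open>0 < \<epsilon>\<close> by (auto simp: \<delta>_def)
  have approx: "\<exists>c n u. u = (\<lambda>x. c * \<phi> ((f ^^ n) x)) \<and> u \<in> Lp_fun M p \<and>
      (\<forall>k. ?m k * ?A k (\<lambda>x. u x - g x) \<le> K * \<delta>)" if g: "g \<in> Lp_fun M p" for g
  proof -
    obtain c n where cn: "Lp_int M p (\<lambda>x. c * \<phi> ((f ^^ n) x) - g x) < \<delta>"
      using dense[OF g \<delta>(1)] by blast
    have u: "(\<lambda>x. c * \<phi> ((f ^^ n) x)) \<in> Lp_fun M p"
      using Lp_fun_int_iterate[OF \<phi>, of "int n"] by (simp add: int_iterate_of_nat Lp_fun_scale)
    have "?m k * ?A k (\<lambda>x. c * \<phi> ((f ^^ n) x) - g x) \<le> K * \<delta>" for k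
      using K(2)[OF Lp_fun_diff[OF p u g], of k] mult_left_mono[OF less_imp_le[OF cn], of K] K(1)
      by linarith
    then show ?thesis using u by blast
  qed
  obtain c n u where u: "u = (\<lambda>x. c * \<phi> ((f ^^ n) x))" "u \<in> Lp_fun M p"
    "\<And>k. ?m k * ?A k (\<lambda>x. u x - ?e 0 x) \<le> K * \<delta>"
    using approx[OF indicator_level_Lp_fun[of 0]] by blast
  have e01: "(\<lambda>x. ?e 0 x + ?e 1 x) \<in> Lp_fun M p"
    by (intro Lp_fun_add p indicator_level_Lp_fun)
  obtain c' n' v where v: "v = (\<lambda>x. c' * \<phi> ((f ^^ n') x))" "v \<in> Lp_fun M p"
    "\<And>k. ?m k * ?A k (\<lambda>x. v x - (?e 0 x + ?e 1 x)) \<le> K * \<delta>"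
    using approx[OF e01] by blast
  have Au: "?A k u = cmod c powr p * ?A (int n + k) \<phi>" for k
    unfolding u(1) by (simp add: fibre_int_scale fibre_int_comp flip: int_iterate_of_nat)
  have Av: "?A k v = cmod c' powr p * ?A (int n' + k) \<phi>" for k
    unfolding v(1) by (simp add: fibre_int_scale fibre_int_comp flip: int_iterate_of_nat)
  define n0 where "n0 = int n' - int n"
  \<comment> \<open>Both sides are the same multiple of the fibre integral of \<open>\<phi>\<close>
    at \<open>int n' + k\<close>: up to a constant, the fibres of \<open>v\<close> are those of
    \<open>u\<close> shifted by \<open>n0\<close>.\<close>
  have swap: "cmod c powr p * ?A k v = cmod c' powr p * ?A (k + n0) u" for k
    by (simp add: Au Av n0_def algebra_simps)
  have e01_fibre: "?A k (\<lambda>x. ?e 0 x + ?e 1 x) = (if k = 0 \<or> k = 1 then w else 0)" for k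
  proof -
    have eq: "indicator W x * (?e 0 (int_iterate f k x) + ?e 1 (int_iterate f k x))
        = indicator W x * (if k = 0 then ?e 0 (int_iterate f k x) else ?e 1 (int_iterate f k x))" for x
      by (auto simp: W_iff level_int_iterate indicator_def)
    have "?A k (\<lambda>x. ?e 0 x + ?e 1 x) = (if k = 0 then ?A k (?e 0) else ?A k (?e 1))"
      unfolding fibre_int_def eq by simp
    then show ?thesis
      by (simp add: fibre_int_indicator_level w_def)
  qed
  have small: "?A k d \<le> w / (8 * b ^ 4)" if "?m k * ?A k d \<le> K * \<delta>" "k \<in> {-1, 0, 1}" for k d
  proof -
    have "\<mu> * ?A k d \<le> ?m k * ?A k d"
      using \<mu> that(2) fibre_int_nonneg by (intro mult_right_mono) auto
    also have "\<dots> \<le> K * (\<mu> * w / (8 * b ^ 4 * K))"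
      using that(1) \<delta>(3) K(1) mult_left_mono[of \<delta> _ K] by (meson less_imp_le order_trans)
    also have "\<dots> = \<mu> * (w / (8 * b ^ 4))"
      using K(1) b by (simp add: field_simps)
    finally show ?thesis
      by (rule mult_left_le_imp_le[OF _ \<mu>(1)])
  qed
  have b4: "b \<le> b ^ 4"
    using power_increasing[of 1 4 b] b by simp
  \<comment> \<open>With an error of at most \<open>w / (8 * b)\<close>, the inequality
    \<open>w \<le> b * (error + ?A k d)\<close> leaves at least \<open>7 * w / (8 * b)\<close> for
    \<open>?A k d\<close>.\<close>
  have lower: "w / (2 * b) \<le> ?A k d" 
    if "d \<in> Lp_fun M p" "g \<in> Lp_fun M p" "?A k g = w" "?A k (\<lambda>x. d x - g x) \<le> w / (8 * b ^ 4)" for k d g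
  proof -
    have "?A k (\<lambda>x. g x - d x) = ?A k (\<lambda>x. d x - g x)"
      using fibre_int_scale[of p k "-1" "\<lambda>x. d x - g x"] by simp
    then have "w \<le> b * (?A k (\<lambda>x. d x - g x) + ?A k d)"
      using fibre_int_add_le[OF p Lp_fun_diff[OF p that(2,1)] that(1), of k] that(3) by (simp add: b_def)
    also have "\<dots> \<le> b * (w / (8 * b) + ?A k d)"
    proof -
      have "w / (8 * b ^ 4) \<le> w / (8 * b)"
        using w b b4 by (intro divide_left_mono) auto
      then show ?thesis using that(4) b by (intro mult_left_mono add_right_mono) auto
    qed
    also have "\<dots> = w / 8 + b * ?A k d"
      using b by (simp add: field_simps)
    finally show ?thesis
      using b w by (simp add: field_simps)
  qed
  have upper: "?A k d \<le> 2 * b * w"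
    if "d \<in> Lp_fun M p" "g \<in> Lp_fun M p" "?A k g = w" "?A k (\<lambda>x. d x - g x) \<le> w / (8 * b ^ 4)" for k d g
  proof -
    have "w / (8 * b ^ 4) \<le> w / 1"
      using w b b4 by (intro divide_left_mono) auto
    then have *: "b * (?A k (\<lambda>x. d x - g x) + ?A k g) \<le> b * (w + w)"
      using that b by (intro mult_left_mono) auto
    have "?A k d \<le> b * (?A k (\<lambda>x. d x - g x) + ?A k g)"
      using fibre_int_add_le[OF p Lp_fun_diff[OF p that(1,2)] that(2), of k] by (simp add: b_def)
    also note *
    finally show ?thesis
      by (simp add: algebra_simps)
  qed
  note Lf = indicator_level_Lp_fun[of 0]
  have e0: "?A 0 (?e 0) = w" by (simp add: fibre_int_indicator_level w_def)
  have u0: "w / (2 * b) \<le> ?A 0 u" 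
    using lower[OF u(2) Lf e0 small[OF u(3)]] by simp
  have v0: "w / (2 * b) \<le> ?A 0 v" "?A 0 v \<le> 2 * b * w"
    using lower[OF v(2) e01 _ small[OF v(3)]] upper[OF v(2) e01 _ small[OF v(3)]] by (simp_all add: e01_fibre)
  have v1: "w / (2 * b) \<le> ?A 1 v" "?A 1 v \<le> 2 * b * w"
    using lower[OF v(2) e01 _ small[OF v(3)]] upper[OF v(2) e01 _ small[OF v(3)]] by (simp_all add: e01_fibre)
  have u_off: "?A k u = ?A k (\<lambda>x. u x - ?e 0 x)" if "k \<noteq> 0" for k
    unfolding fibre_int_def Lp_int_def using that
    by (intro Bochner_Integration.integral_cong) (auto simp: indicator_def W_iff level_int_iterate)
  have v_off: "?A k v = ?A k (\<lambda>x. v x - (?e 0 x + ?e 1 x))" if "k \<noteq> 0" "k \<noteq> 1" for k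
    unfolding fibre_int_def Lp_int_def using that
    by (intro Bochner_Integration.integral_cong) (auto simp: indicator_def W_iff level_int_iterate)
  \<comment> \<open>The unknown scalars enter only through \<open>r\<close>. Its denominator is
    nonzero because \<open>u\<close> has mass on level 0.\<close>
  define r where "r = cmod c' powr p / cmod c powr p"
  have "cmod c powr p \<noteq> 0"
    using u0 w b unfolding Au[of 0] by (auto simp: field_simps)
  then have c: "0 < cmod c powr p" by simp
  have r: "?A k v = r * ?A (k + n0) u" for k
    using swap[of k] c by (simp add: r_def field_simps)
  have r0: "0 \<le> r" by (simp add: r_def)
  \<comment> \<open>If \<open>n0\<close> is 0 or -1, then level 0 of \<open>u\<close> and one of the levels 1, -1 are matched with the levels 0 and 1 of \<open>v\<close>.\<close>
  have contra: False if "r * ?A 0 u \<le> 2 * b * w" "w / (2 * b) \<le> r * ?A k u" "k = 1 \<or> k = -1" for k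
  proof -
    have "r * (w / (2 * b)) \<le> 2 * b * w"
      using mult_left_mono[OF u0 r0] that(1) by linarith
    then have r4: "r \<le> 4 * b ^ 2"
      using w b by (simp add: field_simps power2_eq_square)
    have "?A k u \<le> w / (8 * b ^ 4)"
      using u_off[of k] small[OF u(3)[of k]] that(3) by auto
    \<comment> \<open>The power \<open>b ^ 4\<close> in \<open>\<delta>\<close> outweighs the factor
      \<open>4 * b ^ 2\<close>: what remains, \<open>w / (2 * b ^ 2)\<close>, is below
      \<open>w / (2 * b)\<close> since \<open>b > 1\<close>.\<close>
    then have "r * ?A k u \<le> 4 * b ^ 2 * (w / (8 * b ^ 4))"
      using r4 r0 fibre_int_nonneg by (intro mult_mono) auto
    also have "\<dots> = w / (2 * b ^ 2)"
      using b by (simp add: field_simps eval_nat_numeral)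
    also have "\<dots> < w / (2 * b)"
      using w b by (intro divide_strict_left_mono) (auto simp: power2_eq_square)
    finally show False using that(2) by simp
  qed
  \<comment> \<open>These are exactly the exclusions under which the target of \<open>u\<close>
    vanishes on level \<open>n0\<close> and that of \<open>v\<close> on level
    \<open>- n0\<close>.\<close>
  have n0: "n0 \<noteq> 0" "n0 \<noteq> -1"
    using contra[of 1] r[of 0] r[of 1] v0 v1 contra[of "-1"] by auto
  \<comment> \<open>On level \<open>- n0\<close> the function \<open>v\<close> inherits
    \<open>r\<close> times the mass of \<open>u\<close> on level 0, although its target vanishes
    there.\<close>
  have 1: "r * (w / (2 * b)) * ?m (- n0) \<le> K * \<delta>"
  proof -
    have "r * (w / (2 * b)) \<le> ?A (- n0) v"
      using mult_left_mono[OF u0 r0] r[of "- n0"] by simp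
    then have "?m (- n0) * (r * (w / (2 * b))) \<le> ?m (- n0) * ?A (- n0) (\<lambda>x. v x - (?e 0 x + ?e 1 x))"
      using v_off[of "- n0"] n0 less_imp_le[OF wandering_measure_pos] by (intro mult_left_mono) auto
    then show ?thesis using v(3)[of "- n0"] by (simp add: mult_ac)
  qed
  \<comment> \<open>The reverse comparison: the mass of \<open>v\<close> on level 0 comes from level
    \<open>n0\<close> of \<open>u\<close>, where the target of \<open>u\<close> vanishes. Here
    \<open>r\<close> stands on the other side.\<close>
  have 2: "(w / (2 * b)) * ?m n0 \<le> r * (K * \<delta>)"
  proof -
    have "(w / (2 * b)) * ?m n0 \<le> r * ?A n0 u * ?m n0"
      using v0(1) r[of 0] less_imp_le[OF wandering_measure_pos] by (intro mult_right_mono) auto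
    also have "\<dots> = r * (?m n0 * ?A n0 (\<lambda>x. u x - ?e 0 x))"
      using u_off[OF n0(1)] by simp
    also have "\<dots> \<le> r * (K * \<delta>)"
      using u(3) r0 by (intro mult_left_mono)
    finally show ?thesis .
  qed
  have rpos: "0 < r"
  proof -
    have "0 < (w / (2 * b)) * ?m n0"
      using w b wandering_measure_pos by simp
    then show ?thesis using 2 r0 by (cases "r = 0") auto
  qed
  have "(r * (w / (2 * b)) * ?m (- n0)) * ((w / (2 * b)) * ?m n0) \<le> (K * \<delta>) * (r * (K * \<delta>))"
    by (rule mult_mono[OF 1 2]) (use K(1) \<delta>(1) w b less_imp_le[OF wandering_measure_pos] in auto)
  then have "r * ((w / (2 * b))\<^sup>2 * (?m (- n0) * ?m n0)) \<le> r * (K * \<delta>)\<^sup>2"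
    by (simp add: power2_eq_square mult_ac)
  then have *: "(w / (2 * b))\<^sup>2 * (?m (- n0) * ?m n0) \<le> (K * \<delta>)\<^sup>2"
    using rpos by simp
  have "K * \<delta> \<le> K * (sqrt \<epsilon> * w / (2 * b * K) / 2)"
    using \<delta>(2) K(1) by (intro mult_left_mono) auto
  also have "\<dots> < (w / (2 * b)) * sqrt \<epsilon>"
    using K(1) w b \<open>0 < \<epsilon>\<close> by (simp add: field_simps)
  finally have "(K * \<delta>)\<^sup>2 < ((w / (2 * b)) * sqrt \<epsilon>)\<^sup>2"
    using K(1) \<delta>(1) by (intro power_strict_mono) auto
  also have "\<dots> = (w / (2 * b))\<^sup>2 * \<epsilon>"
    using \<open>0 < \<epsilon>\<close> by (simp only: power_mult_distrib real_sqrt_pow2 less_imp_le)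
  finally have "(w / (2 * b))\<^sup>2 * (?m (- n0) * ?m n0) < (w / (2 * b))\<^sup>2 * \<epsilon>"
    using * by linarith
  then have fin: "?m (- n0) * ?m n0 < \<epsilon>"
    using w b by simp
  \<comment> \<open>The product is symmetric under \<open>n0\<close> and \<open>- n0\<close>, so
    either sign of \<open>n0\<close> yields a natural number.\<close>
  show ?thesis
  proof (cases n0 rule: int_cases2)
    case (nonneg n)
    then show ?thesis using fin by auto
  next
    case (nonpos n)
    then show ?thesis using fin by (intro exI[of _ n]) (simp add: mult.commute)
  qed
qed

text \<open>The finitely many products with index below \<open>N\<close> are positive; a bound not
  exceeding any of them forces the index to be at least \<open>N\<close>.\<close>

lemma supercyclic_imp_liminf:
  assumes "1 \<le> p" "\<phi> \<in> Lp_fun M p"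
    and "\<And>g \<epsilon>. g \<in> Lp_fun M p \<Longrightarrow> 0 < \<epsilon> \<Longrightarrow> \<exists>c n. Lp_int M p (\<lambda>x. c * \<phi> ((f ^^ n) x) - g x) < \<epsilon>"
    and "0 < \<epsilon>"
  shows "\<exists>n\<ge>N. wandering_measure (- int n) * wandering_measure (int n) < \<epsilon>"
proof -
  let ?s = "\<lambda>n. wandering_measure (- int n) * wandering_measure (int n)"
  define \<eta> where "\<eta> = Min (insert \<epsilon> (?s ` {..<N}))"
  have "0 < \<eta>"
    using wandering_measure_pos assms(4) by (auto simp: \<eta>_def)
  then obtain n where n: "?s n < \<eta>"
    using supercyclic_imp_wandering_small[OF assms(1-3)] by blast
  have "\<eta> \<le> \<epsilon>" "\<And>i. i < N \<Longrightarrow> \<eta> \<le> ?s i"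
    by (auto simp: \<eta>_def)
  then show ?thesis
    using n by (metis linorder_not_less order_less_le_trans)
qed

end

section \<open>A countable dense set of functions on finitely many levels\<close>


definition Lp_closure :: "'a measure \<Rightarrow> real \<Rightarrow> ('a \<Rightarrow> complex) set \<Rightarrow> ('a \<Rightarrow> complex) set" where
  "Lp_closure M p D = {\<phi> \<in> Lp_fun M p. \<forall>\<epsilon>>0. \<exists>d\<in>D. Lp_int M p (\<lambda>x. \<phi> x - d x) < \<epsilon>}"

lemma Lp_closure_closed:
  assumes p: "1 \<le> p" and D: "D \<subseteq> Lp_fun M p" and \<phi>: "\<phi> \<in> Lp_fun M p"
    and approx: "\<And>\<epsilon>. 0 < \<epsilon> \<Longrightarrow> \<exists>\<psi>\<in>Lp_closure M p D. Lp_int M p (\<lambda>x. \<phi> x - \<psi> x) < \<epsilon>"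
  shows "\<phi> \<in> Lp_closure M p D"
proof -
  have "\<exists>d\<in>D. Lp_int M p (\<lambda>x. \<phi> x - d x) < \<epsilon>" if "0 < \<epsilon>" for \<epsilon>
  proof -
    \<comment> \<open>Two errors below \<open>\<delta>\<close>, enlarged by the factor
      \<open>2 powr p\<close> of the triangle inequality, stay below
      \<open>\<epsilon>\<close>.\<close>
    define \<delta> where "\<delta> = \<epsilon> / (2 * 2 powr p)"
    have \<delta>: "0 < \<delta>" "2 powr p * (\<delta> + \<delta>) = \<epsilon>"
      using that by (simp_all add: \<delta>_def)
    obtain \<psi> where \<psi>: "\<psi> \<in> Lp_closure M p D" "Lp_int M p (\<lambda>x. \<phi> x - \<psi> x) < \<delta>"
      using approx[OF \<delta>(1)] by blast
    obtain d where d: "d \<in> D" "Lp_int M p (\<lambda>x. \<psi> x - d x) < \<delta>"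
      using \<psi>(1) \<delta>(1) by (auto simp: Lp_closure_def)
    have "Lp_int M p (\<lambda>x. \<phi> x - d x)
        \<le> 2 powr p * (Lp_int M p (\<lambda>x. \<phi> x - \<psi> x) + Lp_int M p (\<lambda>x. \<psi> x - d x))"
      using \<psi>(1) d(1) D by (intro Lp_int_triangle p \<phi>) (auto simp: Lp_closure_def)
    also have "\<dots> < 2 powr p * (\<delta> + \<delta>)"
      using \<psi>(2) d(2) by (intro mult_strict_left_mono add_strict_mono) auto
    finally show ?thesis
      using d(1) \<delta>(2) by auto
  qed
  then show ?thesis
    using \<phi> by (simp add: Lp_closure_def)
qed

lemma Lp_closure_add:
  assumes p: "1 \<le> p" and D: "D \<subseteq> Lp_fun M p"
    and add: "\<And>d e. d \<in> D \<Longrightarrow> e \<in> D \<Longrightarrow> (\<lambda>x. d x + e x) \<in> D"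
    and \<phi>: "\<phi> \<in> Lp_closure M p D" and \<psi>: "\<psi> \<in> Lp_closure M p D"
  shows "(\<lambda>x. \<phi> x + \<psi> x) \<in> Lp_closure M p D"
proof -
  have L: "\<phi> \<in> Lp_fun M p" "\<psi> \<in> Lp_fun M p"
    using \<phi> \<psi> by (auto simp: Lp_closure_def)
  have "\<exists>d\<in>D. Lp_int M p (\<lambda>x. \<phi> x + \<psi> x - d x) < \<epsilon>" if "0 < \<epsilon>" for \<epsilon>
  proof -
    define \<delta> where "\<delta> = \<epsilon> / (2 * 2 powr p)"
    have \<delta>: "0 < \<delta>" "2 powr p * (\<delta> + \<delta>) = \<epsilon>"
      using that by (simp_all add: \<delta>_def)
    obtain d where d: "d \<in> D" "Lp_int M p (\<lambda>x. \<phi> x - d x) < \<delta>"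
      using \<phi> \<delta>(1) by (auto simp: Lp_closure_def)
    obtain e where e: "e \<in> D" "Lp_int M p (\<lambda>x. \<psi> x - e x) < \<delta>"
      using \<psi> \<delta>(1) by (auto simp: Lp_closure_def)
    have "Lp_int M p (\<lambda>x. (\<phi> x - d x) + (\<psi> x - e x))
        \<le> 2 powr p * (Lp_int M p (\<lambda>x. \<phi> x - d x) + Lp_int M p (\<lambda>x. \<psi> x - e x))"
      using d(1) e(1) D L by (intro Lp_int_add_le Lp_fun_diff p) auto
    also have "\<dots> < 2 powr p * (\<delta> + \<delta>)"
      using d(2) e(2) by (intro mult_strict_left_mono add_strict_mono) auto
    finally show ?thesis
      using add[OF d(1) e(1)] \<delta>(2) by (intro bexI[of _ "\<lambda>x. d x + e x"]) (simp_all add: algebra_simps)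
  qed
  then show ?thesis
    using Lp_fun_add[OF p L] by (simp add: Lp_closure_def)
qed

text \<open>Finite intersections of a countable basis. Stability under intersections allows
  induction over disjoint unions and complements; the empty intersection contributes
  \<open>UNIV\<close>, from which complements are subtracted.\<close>

lemma countable_Int_stable_generator:
  obtains G :: "'a::second_countable_topology set set"
  where "countable G" "Int_stable G" "UNIV \<in> G" "sets borel = sigma_sets UNIV G"
proof -
  obtain B :: "'a set set" where B: "countable B" "topological_basis B"
    using ex_countable_basis by blast
  define G where "G = Inter ` {b. finite b \<and> b \<subseteq> B}"
  have "countable G"
    unfolding G_def by (intro countable_image countable_Collect_finite_subset B)
  moreover have "Int_stable G"
  proof (rule Int_stableI)
    fix a b assume "a \<in> G" "b \<in> G"
    then obtain s t where "a = \<Inter>s" "b = \<Inter>t" "finite s" "finite t" "s \<subseteq> B" "t \<subseteq> B"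
      by (auto simp: G_def)
    then show "a \<inter> b \<in> G"
      unfolding G_def by (intro image_eqI[of _ _ "s \<union> t"]) auto
  qed
  moreover have "UNIV \<in> G"
    unfolding G_def by (intro image_eqI[of _ _ "{}"]) auto
  moreover have "sets borel = sigma_sets UNIV G"
  proof
    have "B \<subseteq> G"
    proof
      fix b assume "b \<in> B"
      then show "b \<in> G"
        unfolding G_def by (intro image_eqI[of _ _ "{b}"]) auto
    qed
    then show "sets borel \<subseteq> sigma_sets UNIV G"
      unfolding borel_eq_countable_basis[OF B] by (simp add: sigma_sets_mono')
    have "open g" if "g \<in> G" for g
      using that B(2) unfolding G_def by (auto intro!: open_Inter dest: topological_basis_open)
    then have "G \<subseteq> sets borel"
      by auto
    then show "sigma_sets UNIV G \<subseteq> sets borel"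
      using sets.sigma_sets_subset[of G "borel :: 'a measure"] by simp
  qed
  ultimately show ?thesis
    by (rule that)
qed

section \<open>Density of bounded functions on finitely many levels\<close>

context dissipative_system
begin

text \<open>Boundedness matters as much as the support: it bounds the \<open>p\<close>-th power
  integral of \<open>y\<close> composed with the \<open>n\<close>-th iterate by a multiple of
  \<open>wandering_measure (- n)\<close>, uniformly in \<open>n\<close>.\<close>

definition finite_level_functions :: "('a \<Rightarrow> complex) set" where
  "finite_level_functions = {y \<in> borel_measurable M.
    \<exists>B q. \<forall>x. cmod (y x) \<le> B \<and> (y x \<noteq> 0 \<longrightarrow> \<bar>level x\<bar> \<le> int q)}"

lemma finite_level_functionsI:
  assumes "y \<in> borel_measurable M" "\<And>x. cmod (y x) \<le> B" "\<And>x. y x \<noteq> 0 \<Longrightarrow> \<bar>level x\<bar> \<le> int q"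
  shows "y \<in> finite_level_functions"
  using assms unfolding finite_level_functions_def by blast

text \<open>Such a function is dominated by \<open>B\<close> times a finite sum of level indicators,
  and levels have finite measure.\<close>

lemma finite_level_functions_subset_Lp_fun:
  assumes "1 \<le> p"
  shows "finite_level_functions \<subseteq> Lp_fun M p"
proof
  fix y assume "y \<in> finite_level_functions"
  then obtain B q where y: "y \<in> borel_measurable M" "\<And>x. cmod (y x) \<le> B"
    "\<And>x. y x \<noteq> 0 \<Longrightarrow> \<bar>level x\<bar> \<le> int q"
    unfolding finite_level_functions_def by blast
  let ?s = "\<lambda>Q x. \<Sum>k\<in>Q. indicator {x. level x = k} x :: complex"
  have s_eq: "?s Q x = (if level x \<in> Q then 1 else 0)" if "finite Q" for Q x
    using that by (simp add: indicator_def)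
  have s: "?s Q \<in> Lp_fun M p" if "finite Q" for Q
    using that
  proof (induction Q)
    case empty
    then show ?case by (simp add: Lp_fun_def)
  next
    case (insert k Q)
    then show ?case
      using Lp_fun_add[OF assms indicator_level_Lp_fun[of k] insert.IH] by simp
  qed
  show "y \<in> Lp_fun M p"
  proof (rule Lp_fun_bound[OF s])
    show "cmod (y x) \<le> B * cmod (?s {- int q..int q} x)" for x
    proof (cases "y x = 0")
      case True
      have "0 \<le> B"
        using order_trans[OF norm_ge_zero y(2)] .
      then show ?thesis
        using True by simp
    next
      case False
      then have "level x \<in> {- int q..int q}"
        using y(3)[of x] by (simp add: abs_le_iff)
      then show ?thesis
        using y(2)[of x] by (subst s_eq) simp_all
    qed
  qed (use y(1) assms in auto)
qed

lemma finite_level_functions_add: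
  assumes "y \<in> finite_level_functions" "z \<in> finite_level_functions"
  shows "(\<lambda>x. y x + z x) \<in> finite_level_functions"
proof -
  obtain B q where y: "y \<in> borel_measurable M" "\<And>x. cmod (y x) \<le> B"
    "\<And>x. y x \<noteq> 0 \<Longrightarrow> \<bar>level x\<bar> \<le> int q"
    using assms(1) unfolding finite_level_functions_def by blast
  obtain B' q' where z: "z \<in> borel_measurable M" "\<And>x. cmod (z x) \<le> B'"
    "\<And>x. z x \<noteq> 0 \<Longrightarrow> \<bar>level x\<bar> \<le> int q'"
    using assms(2) unfolding finite_level_functions_def by blast
  show ?thesis
  proof (rule finite_level_functionsI)
    show "cmod (y x + z x) \<le> B + B'" for x
      using norm_triangle_mono[OF y(2) z(2)] .
    show "\<bar>level x\<bar> \<le> int (max q q')" if "y x + z x \<noteq> 0" for x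
      using y(3)[of x] z(3)[of x] that by (cases "y x = 0") auto
  qed (use y(1) z(1) in auto)
qed

lemma indicator_level_finite_level:
  assumes "A \<in> sets M"
  shows "(\<lambda>x. c * indicator (A \<inter> {x. level x = k}) x) \<in> finite_level_functions"
proof (rule finite_level_functionsI)
  show "(\<lambda>x. c * indicator (A \<inter> {x. level x = k}) x) \<in> borel_measurable M"
    using assms sets_level[of k] by measurable
  show "cmod (c * indicator (A \<inter> {x. level x = k}) x) \<le> cmod c" for x
    by (simp add: indicator_def)
  show "\<bar>level x\<bar> \<le> int (nat \<bar>k\<bar>)" if "c * indicator (A \<inter> {x. level x = k}) x \<noteq> 0" for x
    using that by (auto simp: indicator_def split: if_splits)
qed

lemma Lp_int_indicator_level_le:
  assumes "A \<in> sets M" "1 \<le> p"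
  shows "Lp_int M p (\<lambda>x. c * indicator (A \<inter> {x. level x = k}) x) \<le> cmod c powr p * wandering_measure k"
proof -
  have "cmod (indicator S x) powr p = indicator S x" for S and x :: 'a
    by (simp add: indicator_def)
  then have "Lp_int M p (indicator (A \<inter> {x. level x = k})) = measure M (A \<inter> {x. level x = k})"
    using assms(1) sets_level[of k] by (simp add: Lp_int_def space_eq_UNIV)
  also have "\<dots> \<le> measure M {x. level x = k}"
    using assms(1) sets_level[of k] emeasure_level_finite_pos[of k]
    by (intro measure_mono_fmeasurable) (auto simp: fmeasurable_def)
  also have "\<dots> = wandering_measure k"
    by (simp add: wandering_measure_def image_W_eq)
  finally show ?thesis
    using Lp_int_scale[of M p c "indicator (A \<inter> {x. level x = k})"] by (simp add: mult_left_mono)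
qed

lemma countable_dense_finite_level_functions:
  assumes p: "1 \<le> p"
  obtains D where "countable D" "D \<noteq> {}" "D \<subseteq> finite_level_functions"
    "\<And>g \<epsilon>. g \<in> Lp_fun M p \<Longrightarrow> 0 < \<epsilon> \<Longrightarrow> \<exists>d\<in>D. Lp_int M p (\<lambda>x. g x - d x) < \<epsilon>"
proof -
  obtain Q :: "complex set" where Q: "countable Q" "\<And>X. open X \<Longrightarrow> X \<noteq> {} \<Longrightarrow> \<exists>d\<in>Q. d \<in> X"
    using countable_dense_setE by blast
  obtain G :: "'a set set" where G: "countable G" "Int_stable G" "UNIV \<in> G" "sets borel = sigma_sets UNIV G"
    using countable_Int_stable_generator by blast
  have GM: "A \<in> sets M" if "A \<in> sigma_sets UNIV G" for A
    using that G(4) sets_eq_borel by simp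
  \<comment> \<open>Lists make countability immediate, and addition becomes concatenation.\<close>
  define step where "step = (\<lambda>xs x. \<Sum>(c, A, k)\<leftarrow>xs. c * indicator (A \<inter> {x. level x = k}) x :: complex)"
  define D where "D = step ` lists (Q \<times> G \<times> (UNIV :: int set))"
  have D: "D \<subseteq> finite_level_functions"
  proof -
    have "step xs \<in> finite_level_functions" if "xs \<in> lists (Q \<times> G \<times> UNIV)" for xs
      using that
    proof (induction xs)
      case Nil
      have "step [] = (\<lambda>x. 0)" by (simp add: step_def)
      then show ?case
        using indicator_level_finite_level[of UNIV 0] space_eq_UNIV sets.top[of M] by simp
    next
      case (Cons a xs)
      obtain c A k where a: "a = (c, A, k)" "A \<in> G"
        using Cons by (cases a) auto
      have "step (a # xs) = (\<lambda>x. c * indicator (A \<inter> {x. level x = k}) x + step xs x)"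
        by (simp add: step_def a)
      then show ?case
        using Cons indicator_level_finite_level[of A c k] GM[of A] a(2)
        by (simp add: finite_level_functions_add sigma_sets.Basic)
    qed
    then show ?thesis
      by (auto simp: D_def)
  qed
  have D_add: "(\<lambda>x. d x + e x) \<in> D" if "d \<in> D" "e \<in> D" for d e
  proof -
    obtain xs ys where "d = step xs" "e = step ys" "xs \<in> lists (Q \<times> G \<times> UNIV)" "ys \<in> lists (Q \<times> G \<times> UNIV)"
      using \<open>d \<in> D\<close> \<open>e \<in> D\<close> by (auto simp: D_def)
    then show ?thesis
      unfolding D_def by (intro image_eqI[of _ _ "xs @ ys"]) (auto simp: step_def fun_eq_iff)
  qed
  have D_Lp: "D \<subseteq> Lp_fun M p"
    using D finite_level_functions_subset_Lp_fun[OF p] by blast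
  \<comment> \<open>The closure is shown to contain, in turn, multiples of indicators of generating
    sets cut to one level, then those of Borel sets, simple functions on finitely many levels, and
    all of \<open>Lp_fun M p\<close>.\<close>
  let ?V = "Lp_closure M p D"
  have zero: "(\<lambda>x. 0) \<in> ?V"
  proof -
    have "(\<lambda>x. 0) \<in> D"
      unfolding D_def by (intro image_eqI[of _ _ "[]"]) (auto simp: step_def)
    then show ?thesis
      using D_Lp by (auto simp: Lp_closure_def Lp_int_def intro!: bexI[of _ "\<lambda>x. 0"])
  qed
  have add: "(\<lambda>x. \<phi> x + \<psi> x) \<in> ?V" if "\<phi> \<in> ?V" "\<psi> \<in> ?V" for \<phi> \<psi>
    by (rule Lp_closure_add[OF p D_Lp _ that]) (rule D_add)
  have sum: "(\<lambda>x. \<Sum>i\<in>I. h i x) \<in> ?V" if "finite I" "\<And>i. i \<in> I \<Longrightarrow> h i \<in> ?V" for I :: "'i set" and h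
    using that
  proof (induction I)
    case empty
    then show ?case using zero by simp
  next
    case (insert i I)
    have "h i \<in> ?V" "(\<lambda>x. \<Sum>i\<in>I. h i x) \<in> ?V"
      using insert.prems insert.IH by blast+
    from add[OF this] show ?case
      using insert.hyps by simp
  qed
  have Lp_ind: "(\<lambda>x. c * indicator (A \<inter> {x. level x = k}) x) \<in> Lp_fun M p" if "A \<in> sets M" for c A k
    by (rule subsetD[OF finite_level_functions_subset_Lp_fun[OF p] indicator_level_finite_level[OF that]])
  have generator: "(\<lambda>x. c * indicator (A \<inter> {x. level x = k}) x) \<in> ?V" if A: "A \<in> G" for c A k
  proof -
    have AM: "A \<in> sets M"
      using GM A by (simp add: sigma_sets.Basic)
    have "\<exists>d\<in>D. Lp_int M p (\<lambda>x. c * indicator (A \<inter> {x. level x = k}) x - d x) < \<epsilon>" if "0 < \<epsilon>" for \<epsilon>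
    proof -
      \<comment> \<open>Chosen so that replacing \<open>c\<close> by a coefficient at distance less
        than \<open>\<delta>\<close> costs less than
        \<open>\<delta> powr p * wandering_measure k = \<epsilon>\<close>.\<close>
      define \<delta> where "\<delta> = (\<epsilon> / wandering_measure k) powr (1 / p)"
      have "0 < \<epsilon> / wandering_measure k"
        using that wandering_measure_pos[of k] by simp
      then have \<delta>: "0 < \<delta>" "\<delta> powr p = \<epsilon> / wandering_measure k"
        using p that wandering_measure_pos[of k] by (simp_all add: \<delta>_def powr_powr)
      obtain c' where c': "c' \<in> Q" "c' \<in> ball c \<delta>"
        using Q(2)[of "ball c \<delta>"] \<delta>(1) by auto
      have "cmod (c - c') powr p < \<delta> powr p"
        using c'(2) p by (intro powr_less_mono2) (auto simp: dist_norm)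
      then have "cmod (c - c') powr p * wandering_measure k < \<epsilon>"
        using wandering_measure_pos[of k] by (simp add: \<delta>(2) field_simps)
      then have "Lp_int M p (\<lambda>x. (c - c') * indicator (A \<inter> {x. level x = k}) x) < \<epsilon>"
        using Lp_int_indicator_level_le[OF AM p, of "c - c'" k] by linarith
      moreover have "(\<lambda>x. c' * indicator (A \<inter> {x. level x = k}) x) \<in> D"
        unfolding D_def using c'(1) A by (intro image_eqI[of _ _ "[(c', A, k)]"]) (auto simp: step_def)
      ultimately show ?thesis
        by (intro bexI[of _ "\<lambda>x. c' * indicator (A \<inter> {x. level x = k}) x"]) (simp_all add: algebra_simps)
    qed
    then show ?thesis
      using Lp_ind[OF AM] by (simp add: Lp_closure_def)
  qed
  have "G \<subseteq> Pow UNIV" by simp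
  \<comment> \<open>The quantifier over \<open>c\<close> belongs to the induction: the complement
    step needs the value \<open>- c\<close>, and so far \<open>?V\<close> is known to be closed
    under sums only.\<close>
  have ind: "\<forall>c. (\<lambda>x. c * indicator (A \<inter> {x. level x = k}) x) \<in> ?V" if "A \<in> sigma_sets UNIV G" for A k
    using G(2) \<open>G \<subseteq> Pow UNIV\<close> that
  proof (induction rule: sigma_sets_induct_disjoint)
    case (basic A)
    then show ?case using generator by blast
  next
    case empty
    then show ?case using zero by simp
  next
    case (compl A)
    show ?case
    proof
      fix c :: complex
      have "(\<lambda>x. c * indicator ((UNIV - A) \<inter> {x. level x = k}) x)
        = (\<lambda>x. c * indicator (UNIV \<inter> {x. level x = k}) x + (- c) * indicator (A \<inter> {x. level x = k}) x)"
        by (auto simp: indicator_def fun_eq_iff)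
      then show "(\<lambda>x. c * indicator ((UNIV - A) \<inter> {x. level x = k}) x) \<in> ?V"
        using add[OF generator[OF G(3), of c k] spec[OF compl(2), of "- c"]] by (simp only:)
    qed
  next
    case (union A)
    have AM: "A i \<in> sets M" for i
      using union(2) GM by blast
    show ?case
    proof
      fix c :: complex
      let ?L = "{x. level x = k}"
      \<comment> \<open>Disjointness makes the indicators of the partial unions add up, so that
        closure under sums applies.\<close>
      have part: "(\<lambda>x. c * indicator ((\<Union>i<n. A i) \<inter> ?L) x) \<in> ?V" for n
      proof (induction n)
        case 0
        then show ?case using zero by simp
      next
        case (Suc n)
        have disj: "x \<notin> (\<Union>i<n. A i)" if "x \<in> A n" for x
        proof
          assume "x \<in> (\<Union>i<n. A i)"
          then obtain i where "i < n" "x \<in> A i"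
            by blast
          then show False
            using disjoint_family_onD[OF union(1), of i n] that by auto
        qed
        have "(\<lambda>x. c * indicator ((\<Union>i<Suc n. A i) \<inter> ?L) x)
          = (\<lambda>x. c * indicator ((\<Union>i<n. A i) \<inter> ?L) x + c * indicator (A n \<inter> ?L) x)"
        proof
          fix x
          have "x \<in> (\<Union>i<Suc n. A i) \<longleftrightarrow> x \<in> (\<Union>i<n. A i) \<or> x \<in> A n"
            by (auto simp: less_Suc_eq)
          then show "c * indicator ((\<Union>i<Suc n. A i) \<inter> ?L) x
            = c * indicator ((\<Union>i<n. A i) \<inter> ?L) x + c * indicator (A n \<inter> ?L) x"
            using disj[of x] unfolding indicator_def Int_iff by simp
        qed
        then show ?case
          using add[OF Suc spec[OF union(3), of c n]] by (simp only:)
      qed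
      have UM: "(\<Union>i. A i) \<in> sets M" "(\<Union>i<n. A i) \<in> sets M" for n
        using AM by auto
      let ?s = "\<lambda>n x. c * indicator ((\<Union>i. A i) \<inter> ?L) x - c * indicator ((\<Union>i<n. A i) \<inter> ?L) x"
      \<comment> \<open>Cutting to one level supplies the integrable dominating function, even if
        the union has infinite measure.\<close>
      have conv: "(\<lambda>n. Lp_int M p (?s n)) \<longlonglongrightarrow> 0"
      proof (rule Lp_int_dominated_tendsto_0[OF p indicator_level_Lp_fun[of k]])
        show "?s n \<in> borel_measurable M" for n
          by (intro borel_measurable_diff Lp_fun_measurable[OF Lp_ind] UM)
        show "cmod (?s n x) \<le> cmod c * cmod (indicator ?L x)" for n x
          by (auto simp: indicator_def)
        fix x
        have "(\<lambda>n. indicator (\<Union>i<n. A i) x * (c * indicator ?L x)) \<longlonglongrightarrow> indicator (\<Union>i. A i) x * (c * indicator ?L x)"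
          by (intro tendsto_mult_right LIMSEQ_indicator_UN)
        from tendsto_diff[OF tendsto_const this, of "indicator (\<Union>i. A i) x * (c * indicator ?L x)"]
        show "(\<lambda>n. ?s n x) \<longlonglongrightarrow> 0"
          by (simp add: indicator_inter_arith mult_ac)
      qed
      show "(\<lambda>x. c * indicator ((\<Union>i. A i) \<inter> ?L) x) \<in> ?V"
      proof (rule Lp_closure_closed[OF p D_Lp Lp_ind[OF UM(1)]])
        fix \<epsilon> :: real assume "0 < \<epsilon>"
        then obtain n where "Lp_int M p (?s n) < \<epsilon>"
          using order_tendstoD(2)[OF conv] by (meson eventually_happens trivial_limit_sequentially)
        then show "\<exists>\<psi>\<in>?V. Lp_int M p (\<lambda>x. c * indicator ((\<Union>i. A i) \<inter> ?L) x - \<psi> x) < \<epsilon>"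
          by (intro bexI[OF _ part[of n]])
      qed
    qed
  qed
  have simple: "(\<lambda>x. indicator {x. \<bar>level x\<bar> \<le> int q} x * s x) \<in> ?V" if s: "simple_function M s" for s q
  proof -
    have fin: "finite (range s)"
      using simple_functionD(1)[OF s] by (simp add: space_eq_UNIV)
    have sM: "s -` {v} \<in> sigma_sets UNIV G" for v
      using simple_functionD(2)[OF s, of "{v}"] G(4) sets_eq_borel by (simp add: space_eq_UNIV)
    \<comment> \<open>Finitely many values and finitely many levels: a finite sum of functions
      covered by \<open>ind\<close>.\<close>
    have eq: "indicator {x. \<bar>level x\<bar> \<le> int q} x * s x
        = (\<Sum>v\<in>range s. \<Sum>k\<in>{- int q..int q}. v * indicator (s -` {v} \<inter> {x. level x = k}) x)" for x
    proof -
      have "(\<Sum>v\<in>range s. \<Sum>k\<in>{- int q..int q}. v * indicator (s -` {v} \<inter> {x. level x = k}) x)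
          = (\<Sum>v\<in>range s. if s x = v then \<Sum>k\<in>{- int q..int q}. if level x = k then v else 0 else 0)"
        by (intro sum.cong) (auto simp: indicator_def intro!: sum.cong)
      also have "\<dots> = (\<Sum>k\<in>{- int q..int q}. if level x = k then s x else 0)"
        using fin by (simp add: sum.delta)
      also have "\<dots> = indicator {x. \<bar>level x\<bar> \<le> int q} x * s x"
        by (simp add: sum.delta indicator_def abs_le_iff) (auto)
      finally show ?thesis by simp
    qed
    show ?thesis
      unfolding eq using fin ind[OF sM] by (intro sum) auto
  qed
  have all: "g \<in> ?V" if g: "g \<in> Lp_fun M p" for g
  proof -
    obtain F where F: "\<And>i. simple_function M (F i)" "\<And>x. (\<lambda>i. F i x) \<longlonglongrightarrow> g x"
      "\<And>i x. cmod (F i x) \<le> 2 * cmod (g x)"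
      using borel_measurable_implies_sequence_metric[OF Lp_fun_measurable[OF g], of 0]
      by (auto simp: space_eq_UNIV)
    \<comment> \<open>Approximation and truncation use the same index; at each point the truncation
      is eventually inactive.\<close>
    let ?h = "\<lambda>i x. indicator {x. \<bar>level x\<bar> \<le> int i} x * F i x"
    have conv: "(\<lambda>i. Lp_int M p (\<lambda>x. g x - ?h i x)) \<longlonglongrightarrow> 0"
    proof (rule Lp_int_dominated_tendsto_0[OF p g])
      show "(\<lambda>x. g x - ?h i x) \<in> borel_measurable M" for i
        using Lp_fun_measurable[OF g] simple[OF F(1), of i]
        by (intro borel_measurable_diff) (auto simp: Lp_closure_def Lp_fun_def)
      \<comment> \<open>The 3 is 1 for \<open>g\<close> plus 2 from the bound on
        \<open>F\<close>.\<close>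
      show "cmod (g x - ?h i x) \<le> 3 * cmod (g x)" for i x
        using norm_triangle_ineq4[of "g x" "?h i x"] F(3)[of i x]
        by (auto simp: indicator_def)
      fix x
      have "\<forall>\<^sub>F i in sequentially. F i x = ?h i x"
        using eventually_ge_at_top[of "nat \<bar>level x\<bar>"] by eventually_elim (auto simp: indicator_def)
      then have "(\<lambda>i. ?h i x) \<longlonglongrightarrow> g x"
        by (rule Lim_transform_eventually[OF F(2)])
      from tendsto_diff[OF tendsto_const this, of "g x"] show "(\<lambda>i. g x - ?h i x) \<longlonglongrightarrow> 0"
        by simp
    qed
    show ?thesis
    proof (rule Lp_closure_closed[OF p D_Lp g])
      fix \<epsilon> :: real assume "0 < \<epsilon>"
      then obtain n where "Lp_int M p (\<lambda>x. g x - ?h n x) < \<epsilon>"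
        using order_tendstoD(2)[OF conv] by (meson eventually_happens trivial_limit_sequentially)
      then show "\<exists>\<psi>\<in>?V. Lp_int M p (\<lambda>x. g x - \<psi> x) < \<epsilon>"
        by (intro bexI[OF _ simple[OF F(1)[of n], of n]])
    qed
  qed
  show ?thesis
  proof
    show "countable D"
      unfolding D_def using Q(1) G(1) by (intro countable_image countable_lists countable_SIGMA) auto
    show "D \<noteq> {}"
      by (auto simp: D_def)
    show "\<exists>d\<in>D. Lp_int M p (\<lambda>x. g x - d x) < \<epsilon>" if "g \<in> Lp_fun M p" "0 < \<epsilon>" for g \<epsilon>
      using all[OF that(1)] that(2) by (simp add: Lp_closure_def)
  qed (use D in auto)
qed

end

section \<open>Sufficiency\<close>


lemma suminf_at_most_one:
  fixes z :: "nat \<Rightarrow> 'b::{t2_space, topological_comm_monoid_add}"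
  assumes "\<And>i j. z i \<noteq> 0 \<Longrightarrow> z j \<noteq> 0 \<Longrightarrow> i = j"
  obtains k where "suminf z = z k" "\<And>i. i \<noteq> k \<Longrightarrow> z i = 0"
proof -
  have "\<exists>k. \<forall>i. i \<noteq> k \<longrightarrow> z i = 0"
    using assms by metis
  then obtain k where k: "\<And>i. i \<noteq> k \<Longrightarrow> z i = 0"
    by blast
  moreover have "suminf z = z k"
    using suminf_finite[of "{k}" z] k by simp
  ultimately show ?thesis
    using that by blast
qed

lemma term_le_suminf_ennreal: "g k \<le> (\<Sum>i. g i)" for g :: "nat \<Rightarrow> ennreal"
  using sum_le_suminf[of g "{k}"] by simp

text \<open>The sum equals its one possibly nonzero term, at index \<open>k\<close>. In the second
  bound, \<open>k = j\<close> makes the left side 0; otherwise \<open>z j = 0\<close> and the term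
  at \<open>k\<close> is still present on the right.\<close>

lemma powr_suminf_at_most_one_le:
  fixes z :: "nat \<Rightarrow> complex"
  assumes z: "\<And>i j. z i \<noteq> 0 \<Longrightarrow> z j \<noteq> 0 \<Longrightarrow> i = j"
  shows "ennreal (cmod (suminf z) powr p) \<le> (\<Sum>i. ennreal (cmod (z i) powr p))"
    and "ennreal (cmod (suminf z - z j) powr p) \<le> (\<Sum>i. if i = j then 0 else ennreal (cmod (z i) powr p))"
proof -
  obtain k where k: "suminf z = z k" "\<And>i. i \<noteq> k \<Longrightarrow> z i = 0"
    using suminf_at_most_one[OF z] by blast
  show "ennreal (cmod (suminf z) powr p) \<le> (\<Sum>i. ennreal (cmod (z i) powr p))"
    unfolding k(1) by (rule term_le_suminf_ennreal)
  show "ennreal (cmod (suminf z - z j) powr p) \<le> (\<Sum>i. if i = j then 0 else ennreal (cmod (z i) powr p))"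
  proof (cases "k = j")
    case False
    then show ?thesis
      using term_le_suminf_ennreal[of "\<lambda>i. if i = j then 0 else ennreal (cmod (z i) powr p)" k] k(2)[of j]
      by (simp add: k(1))
  qed (simp add: k(1))
qed

lemma suminf_half_ennreal:
  assumes "0 \<le> a"
  shows "(\<Sum>i. ennreal ((1 / 2) ^ Suc i * a)) = ennreal a"
  using assms sums_mult2[OF power_half_series, of a] by (intro suminf_ennreal_eq) auto

lemma Lp_fun_nn_integral_le:
  assumes "\<phi> \<in> borel_measurable M" "(\<integral>\<^sup>+x. ennreal (cmod (\<phi> x) powr p) \<partial>M) \<le> ennreal a" "0 \<le> a"
  shows "\<phi> \<in> Lp_fun M p" "Lp_int M p \<phi> \<le> a"
proof -
  have "(\<integral>\<^sup>+x. ennreal (cmod (\<phi> x) powr p) \<partial>M) < \<infinity>"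
    using le_less_trans[OF assms(2)] by simp
  then show L: "\<phi> \<in> Lp_fun M p"
    using assms(1) by (simp add: Lp_fun_def integrable_iff_bounded)
  then show "Lp_int M p \<phi> \<le> a"
    using assms(2,3) by (simp add: Lp_fun_def Lp_int_def nn_integral_eq_integral)
qed

section \<open>Construction of the supercyclic vector\<close>

context dissipative_system
begin

text \<open>The composed function lives on the levels \<open>- n + k\<close> with
  \<open>\<bar>k\<bar> \<le> q\<close>, whose measures are at most
  \<open>C ^ nat \<bar>k\<bar>\<close> times that of level \<open>- n\<close>.\<close>

lemma nn_integral_finite_level_iterate_le:
  assumes y: "y \<in> finite_level_functions" and p: "1 \<le> p"
  obtains b where "0 < b"
    "\<And>n. (\<integral>\<^sup>+x. ennreal (cmod (y (int_iterate f n x)) powr p) \<partial>M) \<le> ennreal (b * wandering_measure (- n))"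
proof -
  obtain B q where y: "y \<in> borel_measurable M" "\<And>x. cmod (y x) \<le> B"
    "\<And>x. y x \<noteq> 0 \<Longrightarrow> \<bar>level x\<bar> \<le> int q"
    using y unfolding finite_level_functions_def by blast
  obtain C :: real where C: "1 \<le> C" "\<And>j k. wandering_measure (k + j) \<le> C ^ nat \<bar>j\<bar> * wandering_measure k"
    using wandering_measure_ratio by blast
  let ?I = "{- int q..int q}"
  define c where "c = B powr p * (\<Sum>k\<in>?I. C ^ nat \<bar>k\<bar>)"
  have c: "0 \<le> c"
    unfolding c_def using C(1) by (intro mult_nonneg_nonneg sum_nonneg) auto
  \<comment> \<open>\<open>c + 1\<close> replaces \<open>c\<close> because \<open>c\<close> may be
    0, as for \<open>B = 0\<close>, while the constant has to be positive.\<close>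
  have "(\<integral>\<^sup>+x. ennreal (cmod (y (int_iterate f n x)) powr p) \<partial>M) \<le> ennreal ((c + 1) * wandering_measure (- n))" for n
  proof -
    have "ennreal (cmod (y (int_iterate f n x)) powr p)
        \<le> (\<Sum>k\<in>?I. ennreal (B powr p) * indicator {x. level x = - n + k} x)" for x
    proof (cases "y (int_iterate f n x) = 0")
      case False
      then have "level x + n \<in> ?I"
        using y(3)[of "int_iterate f n x"] by (simp add: level_int_iterate abs_le_iff)
      then have "ennreal (B powr p) * indicator {x. level x = - n + (level x + n)} x
          \<le> (\<Sum>k\<in>?I. ennreal (B powr p) * indicator {x. level x = - n + k} x)"
        by (subst sum.remove[of ?I "level x + n"]) auto
      moreover have "ennreal (cmod (y (int_iterate f n x)) powr p)
          \<le> ennreal (B powr p) * indicator {x. level x = - n + (level x + n)} x"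
        using y(2)[of "int_iterate f n x"] p by (auto intro!: ennreal_leI powr_mono2)
      ultimately show ?thesis
        by (rule order_trans[rotated])
    qed simp
    then have "(\<integral>\<^sup>+x. ennreal (cmod (y (int_iterate f n x)) powr p) \<partial>M)
        \<le> (\<integral>\<^sup>+x. (\<Sum>k\<in>?I. ennreal (B powr p) * indicator {x. level x = - n + k} x) \<partial>M)"
      by (intro nn_integral_mono)
    also have "\<dots> = (\<Sum>k\<in>?I. ennreal (B powr p) * ennreal (wandering_measure (- n + k)))"
      using sets_level by (subst nn_integral_sum) (simp_all add: nn_integral_cmult emeasure_level)
    also have "\<dots> = ennreal (\<Sum>k\<in>?I. B powr p * wandering_measure (- n + k))"
      using less_imp_le[OF wandering_measure_pos] by (simp add: sum_ennreal flip: ennreal_mult)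
    also have "\<dots> \<le> ennreal ((c + 1) * wandering_measure (- n))"
    proof (rule ennreal_leI)
      have "(\<Sum>k\<in>?I. B powr p * wandering_measure (- n + k))
          \<le> (\<Sum>k\<in>?I. B powr p * (C ^ nat \<bar>k\<bar> * wandering_measure (- n)))"
        by (intro sum_mono mult_left_mono C(2)) auto
      also have "\<dots> = c * wandering_measure (- n)"
        by (simp add: c_def sum_distrib_left sum_distrib_right mult_ac)
      also have "\<dots> \<le> (c + 1) * wandering_measure (- n)"
        using less_imp_le[OF wandering_measure_pos] by (intro mult_right_mono) auto
      finally show "(\<Sum>k\<in>?I. B powr p * wandering_measure (- n + k)) \<le> (c + 1) * wandering_measure (- n)" .
    qed
    finally show ?thesis .
  qed
  then show ?thesis
    using that[of "c + 1"] c by simp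
qed

lemma supercyclic_vector_exists:
  assumes p: "1 \<le> p"
    and small: "\<forall>\<epsilon>>0. \<forall>N. \<exists>n\<ge>N. wandering_measure (- int n) * wandering_measure (int n) < \<epsilon>"
  shows "\<exists>\<phi>\<in>Lp_fun M p. \<forall>g\<in>Lp_fun M p. \<forall>\<epsilon>>0. \<exists>c n. Lp_int M p (\<lambda>x. c * \<phi> ((f ^^ n) x) - g x) < \<epsilon>"
proof -
  let ?m = wandering_measure
  note m_pos = wandering_measure_pos and m_nonneg = less_imp_le[OF wandering_measure_pos]
  obtain C :: real where C: "1 \<le> C" "\<And>j k. ?m (k + j) \<le> C ^ nat \<bar>j\<bar> * ?m k"
    using wandering_measure_ratio by blast
  obtain D where D: "countable D" "D \<noteq> {}" "D \<subseteq> finite_level_functions"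
    "\<And>g \<epsilon>. g \<in> Lp_fun M p \<Longrightarrow> 0 < \<epsilon> \<Longrightarrow> \<exists>d\<in>D. Lp_int M p (\<lambda>x. g x - d x) < \<epsilon>"
    using countable_dense_finite_level_functions[OF p] by blast
  \<comment> \<open>Keeping only the first component of the decoded pair makes every element of
    \<open>D\<close> occur at arbitrarily large indices.\<close>
  define y where "y j = from_nat_into D (fst (prod_decode j))" for j
  have y_D: "y j \<in> D" for j
    using from_nat_into[OF D(2)] by (simp add: y_def)
  have y_cofinal: "\<exists>j\<ge>J. y j = d" if d: "d \<in> D" for d J
  proof -
    obtain i where i: "from_nat_into D i = d"
      using from_nat_into_surj[OF D(1) d] by blast
    have "y (prod_encode (i, J)) = d"
      by (simp add: y_def i)
    then show ?thesis
      using le_prod_encode_2[of J i] by blast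
  qed
  have "\<exists>q. \<forall>x. y j x \<noteq> 0 \<longrightarrow> \<bar>level x\<bar> \<le> int q" for j
    using y_D[of j] D(3) unfolding finite_level_functions_def by blast
  then obtain q where q: "\<And>j x. y j x \<noteq> 0 \<Longrightarrow> \<bar>level x\<bar> \<le> int (q j)"
    by metis
  define N where "N j n = (\<integral>\<^sup>+x. ennreal (cmod (y j (int_iterate f n x)) powr p) \<partial>M)" for j n
  have "\<exists>b>0. \<forall>n. N j n \<le> ennreal (b * ?m (- n))" for j
    unfolding N_def using y_D[of j] D(3) nn_integral_finite_level_iterate_le[OF _ p, of "y j"] by blast
  then obtain b where b: "\<And>j. 0 < b j" "\<And>j n. N j n \<le> ennreal (b j * ?m (- n))"
    by metis
  have y_meas [measurable]: "y j \<in> borel_measurable M" for j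
    using y_D[of j] D(3) unfolding finite_level_functions_def by blast
  define \<sigma> where "\<sigma> n = sqrt (?m (- int n) * ?m (int n))" for n
  \<comment> \<open>The weight that balances the two sides: \<open>s n * ?m (int n)\<close> and
    \<open>?m (- int n) / s n\<close> are both equal to \<open>\<sigma> n\<close>. It will be the
    \<open>p\<close>-th power of the coefficient \<open>c\<close>.\<close>
  define s where "s n = sqrt (?m (- int n) / ?m (int n))" for n
  have s_pos: "0 < s n" for n
    using m_pos by (simp add: s_def)
  have s_m: "s n * ?m (int n) = \<sigma> n" and \<sigma>_s: "\<sigma> n * s n = ?m (- int n)" for n
  proof -
    have "s n * ?m (int n) = sqrt (?m (- int n) / ?m (int n) * (?m (int n))\<^sup>2)"
      using m_nonneg[of "int n"] by (simp only: s_def real_sqrt_mult real_sqrt_abs abs_of_nonneg)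
    also have "\<dots> = \<sigma> n"
      using m_pos[of "int n"] by (simp add: \<sigma>_def power2_eq_square)
    finally show "s n * ?m (int n) = \<sigma> n" .
    have "\<sigma> n * s n = sqrt ((?m (- int n) * ?m (int n)) * (?m (- int n) / ?m (int n)))"
      by (simp only: \<sigma>_def s_def real_sqrt_mult)
    also have "(?m (- int n) * ?m (int n)) * (?m (- int n) / ?m (int n)) = (?m (- int n))\<^sup>2"
      using m_pos[of "int n"] by (simp add: power2_eq_square)
    also have "sqrt \<dots> = ?m (- int n)"
      using m_nonneg[of "- int n"] by simp
    finally show "\<sigma> n * s n = ?m (- int n)" .
  qed
  have "\<exists>n\<ge>i. ?m (- int n) * ?m (int n) < inverse (real (Suc i))" for i
    using small by simp
  then obtain t where t: "\<And>i. i \<le> t i" "\<And>i. ?m (- int (t i)) * ?m (int (t i)) < inverse (real (Suc i))"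
    by metis
  have t_top: "filterlim t at_top sequentially"
    using t(1) by (intro filterlim_at_top_mono[OF filterlim_ident]) auto
  have "(\<lambda>i. ?m (- int (t i)) * ?m (int (t i))) \<longlonglongrightarrow> 0"
    by (rule real_tendsto_sandwich[OF _ _ tendsto_const LIMSEQ_inverse_real_of_nat])
      (intro always_eventually allI mult_nonneg_nonneg m_nonneg less_imp_le[OF t(2)])+
  then have \<sigma>_t: "(\<lambda>i. \<sigma> (t i)) \<longlonglongrightarrow> 0"
    unfolding \<sigma>_def using tendsto_real_sqrt by fastforce
  \<comment> \<open>Requirements on the next index \<open>r\<close> given the earlier
    \<open>h i\<close>: a gap keeping the supports disjoint, a small contribution of term
    \<open>i\<close> when term \<open>j\<close> is approximated, a small contribution of term
    \<open>j\<close> when term \<open>i\<close> is approximated, and a small norm of term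
    \<open>j\<close>. The powers of 1/2 make the errors for each target summable.\<close>
  define P where "P h j r \<longleftrightarrow> (\<forall>i<j. h i + q i + q j < r
      \<and> \<sigma> r * (s (h i) * (b i * C ^ h i)) \<le> (1/2) ^ Suc i * (1/2) ^ j
      \<and> \<sigma> r * (b j * C ^ h i) \<le> (1/2) ^ Suc j * (1/2) ^ i * s (h i))
      \<and> \<sigma> r * b j \<le> (1/2) ^ Suc j" for h :: "nat \<Rightarrow> nat" and j r
  have "\<exists>h. \<forall>j. P h j (h j)"
  proof (rule dependent_wellorder_choice)
    show "P h j r = P h' j r" if "\<And>i. i < j \<Longrightarrow> h i = h' i" for r h h' j
      using that by (simp add: P_def)
    fix j h
    \<comment> \<open>Apart from the gap, each requirement asks that \<open>\<sigma> r\<close> times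
      a constant be at most a positive number. Along \<open>t\<close> all finitely many requirements
      therefore hold eventually.\<close>
    have ev: "\<forall>\<^sub>F i in sequentially. \<sigma> (t i) * a \<le> e" if "0 < e" for a e
    proof -
      have "(\<lambda>i. \<sigma> (t i) * a) \<longlonglongrightarrow> 0"
        using tendsto_mult_left_zero[OF \<sigma>_t] .
      from order_tendstoD(2)[OF this that] show ?thesis
        by (rule eventually_mono) simp
    qed
    have "\<forall>\<^sub>F i in sequentially. a < t i" for a
      using t_top by (simp add: filterlim_at_top flip: Suc_le_eq)
    then have "\<forall>\<^sub>F k in sequentially. \<forall>i\<in>{..<j}. h i + q i + q j < t k
      \<and> \<sigma> (t k) * (s (h i) * (b i * C ^ h i)) \<le> (1/2) ^ Suc i * (1/2) ^ j
      \<and> \<sigma> (t k) * (b j * C ^ h i) \<le> (1/2) ^ Suc j * (1/2) ^ i * s (h i)"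
      using s_pos by (intro eventually_ball_finite ballI eventually_conj ev mult_pos_pos) simp_all
    moreover have "\<forall>\<^sub>F k in sequentially. \<sigma> (t k) * b j \<le> (1/2) ^ Suc j"
      by (rule ev) simp
    ultimately have "\<forall>\<^sub>F k in sequentially. P h j (t k)"
      by eventually_elim (simp add: P_def)
    then show "\<exists>r. P h j r"
      by (meson eventually_happens trivial_limit_sequentially)
  qed
  then obtain n where n: "\<And>j. P n j (n j)"
    by blast
  \<comment> \<open>The later of the two indices supplies the small factor \<open>\<sigma>\<close>,
    the earlier one only a power of \<open>C\<close>. For \<open>i < j\<close> the factor arises
    from \<open>?m (- int (n j))\<close>, for \<open>j < i\<close> from
    \<open>s (n i) * ?m (int (n i))\<close>.\<close>
  have cross: "ennreal (s (n i)) * N i (int (n j) - int (n i)) \<le> ennreal ((1/2) ^ Suc i * ((1/2) ^ j * s (n j)))"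
    if "i \<noteq> j" for i j
  proof -
    have "s (n i) * (b i * ?m (int (n i) - int (n j))) \<le> (1/2) ^ Suc i * ((1/2) ^ j * s (n j))"
    proof (cases "i < j")
      case True
      have "s (n i) * (b i * ?m (int (n i) - int (n j))) \<le> s (n i) * (b i * (C ^ n i * ?m (- int (n j))))"
        using C(2)[of "- int (n j)" "int (n i)"] b(1)[of i] s_pos[of "n i"]
        by (intro mult_left_mono) (auto simp: add.commute)
      also have "\<dots> = \<sigma> (n j) * (s (n i) * (b i * C ^ n i)) * s (n j)"
        by (simp add: mult_ac flip: \<sigma>_s)
      also have "\<dots> \<le> (1/2) ^ Suc i * (1/2) ^ j * s (n j)"
        using n[of j] True s_pos[of "n j"] unfolding P_def by (intro mult_right_mono) auto
      finally show ?thesis by (simp only: mult.assoc)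
    next
      case False
      then have "j < i" using that by simp
      have "s (n i) * (b i * ?m (int (n i) - int (n j))) \<le> s (n i) * (b i * (C ^ n j * ?m (int (n i))))"
        using C(2)[of "int (n i)" "- int (n j)"] b(1)[of i] s_pos[of "n i"]
        by (intro mult_left_mono) auto
      also have "\<dots> = \<sigma> (n i) * (b i * C ^ n j)"
        by (simp add: mult_ac flip: s_m)
      also have "\<dots> \<le> (1/2) ^ Suc i * (1/2) ^ j * s (n j)"
        using n[of i] \<open>j < i\<close> unfolding P_def by blast
      finally show ?thesis by (simp only: mult.assoc)
    qed
    note le = this
    have "ennreal (s (n i)) * N i (int (n j) - int (n i))
        \<le> ennreal (s (n i)) * ennreal (b i * ?m (- (int (n j) - int (n i))))"
      by (intro mult_left_mono b(2)) simp
    also have "\<dots> = ennreal (s (n i) * (b i * ?m (int (n i) - int (n j))))"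
      using s_pos[of "n i"] b(1)[of i] m_nonneg by (simp flip: ennreal_mult)
    also have "\<dots> \<le> ennreal ((1/2) ^ Suc i * ((1/2) ^ j * s (n j)))"
      by (rule ennreal_leI[OF le])
    finally show ?thesis .
  qed
  have diag: "ennreal (s (n i)) * N i (- int (n i)) \<le> ennreal ((1/2) ^ Suc i)" for i
  proof -
    have "ennreal (s (n i)) * N i (- int (n i)) \<le> ennreal (s (n i)) * ennreal (b i * ?m (- (- int (n i))))"
      by (intro mult_left_mono b(2)) simp
    also have "\<dots> = ennreal (\<sigma> (n i) * b i)"
      using s_pos[of "n i"] b(1)[of i] m_nonneg by (simp add: mult_ac flip: ennreal_mult s_m)
    also have "\<dots> \<le> ennreal ((1/2) ^ Suc i)"
      using n[of i] unfolding P_def by (intro ennreal_leI) blast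
    finally show ?thesis .
  qed
  define c where "c i = s (n i) powr (1 / p)" for i
  have c_pos: "0 < c i" and c_powr: "c i powr p = s (n i)" for i
    using s_pos[of "n i"] p by (simp_all add: c_def powr_powr)
  define z where "z i x = complex_of_real (c i) * y i (int_iterate f (- int (n i)) x)" for i x
  have z_meas [measurable]: "z i \<in> borel_measurable M" for i
    unfolding z_def by measurable
  have z_powr: "ennreal (cmod (z i (int_iterate f k x)) powr p)
      = ennreal (s (n i)) * ennreal (cmod (y i (int_iterate f (k - int (n i)) x)) powr p)" for i k x
    using c_pos[of i] s_pos[of "n i"] int_iterate_add[of "- int (n i)" k x]
    by (simp add: z_def norm_mult powr_mult c_powr ennreal_mult)
  have z_int: "(\<integral>\<^sup>+x. ennreal (cmod (z i (int_iterate f k x)) powr p) \<partial>M) = ennreal (s (n i)) * N i (k - int (n i))" for i k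
    unfolding z_powr N_def by (simp add: nn_integral_cmult)
  have z_disjoint: "i = j" if "z i x \<noteq> 0" "z j x \<noteq> 0" for i j x
  proof -
    have "\<not> i < j" if "z i x \<noteq> 0" "z j x \<noteq> 0" for i j
    proof
      assume "i < j"
      then have "n i + q i + q j < n j"
        using n[of j] unfolding P_def by blast
      moreover have "\<bar>level x - int (n i)\<bar> \<le> int (q i)" "\<bar>level x - int (n j)\<bar> \<le> int (q j)"
        using q[of i "int_iterate f (- int (n i)) x"] q[of j "int_iterate f (- int (n j)) x"] that
        by (auto simp: z_def level_int_iterate)
      ultimately show False by linarith
    qed
    then show ?thesis
      using that by (meson linorder_neqE_nat)
  qed
  define \<phi> where "\<phi> x = (\<Sum>i. z i x)" for x
  have \<phi>_meas [measurable]: "\<phi> \<in> borel_measurable M"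
    unfolding \<phi>_def by measurable
  have "(\<integral>\<^sup>+x. ennreal (cmod (\<phi> x) powr p) \<partial>M) \<le> (\<integral>\<^sup>+x. (\<Sum>i. ennreal (cmod (z i x) powr p)) \<partial>M)"
    unfolding \<phi>_def by (intro nn_integral_mono powr_suminf_at_most_one_le z_disjoint)
  also have "\<dots> = (\<Sum>i. \<integral>\<^sup>+x. ennreal (cmod (z i x) powr p) \<partial>M)"
    by (intro nn_integral_suminf) simp
  also have "\<dots> \<le> (\<Sum>i. ennreal ((1/2) ^ Suc i * 1))"
    using diag z_int[of _ 0] by (intro suminf_le) auto
  also have "\<dots> = ennreal 1"
    by (rule suminf_half_ennreal) simp
  finally have \<phi>: "\<phi> \<in> Lp_fun M p"
    by (intro Lp_fun_nn_integral_le(1)[of \<phi> M p 1]) auto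
  have approx: "Lp_int M p (\<lambda>x. complex_of_real (1 / c j) * \<phi> ((f ^^ n j) x) - y j x) \<le> (1/2) ^ j" for j
  proof -
    let ?F = "int_iterate f (int (n j))"
    \<comment> \<open>The \<open>n j\<close>-th iterate carries \<open>z j\<close> back to
      \<open>c j * y j\<close> exactly, so only the other summands cause an error, and
      \<open>cross\<close> bounds each of them.\<close>
    let ?d = "\<lambda>x. \<phi> (?F x) - z j (?F x)"
    have "(\<integral>\<^sup>+x. ennreal (cmod (?d x) powr p) \<partial>M)
        \<le> (\<integral>\<^sup>+x. (\<Sum>i. if i = j then 0 else ennreal (cmod (z i (?F x)) powr p)) \<partial>M)"
      unfolding \<phi>_def by (intro nn_integral_mono powr_suminf_at_most_one_le z_disjoint)
    also have "\<dots> = (\<Sum>i. \<integral>\<^sup>+x. (if i = j then 0 else ennreal (cmod (z i (?F x)) powr p)) \<partial>M)"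
      by (intro nn_integral_suminf) simp
    also have "\<dots> \<le> (\<Sum>i. ennreal ((1/2) ^ Suc i * ((1/2) ^ j * s (n j))))"
    proof (intro suminf_le)
      show "(\<integral>\<^sup>+x. (if i = j then 0 else ennreal (cmod (z i (?F x)) powr p)) \<partial>M)
        \<le> ennreal ((1/2) ^ Suc i * ((1/2) ^ j * s (n j)))" for i
        using cross[of i j] z_int[of i "int (n j)"] by (cases "i = j") simp_all
    qed auto
    also have "\<dots> = ennreal ((1/2) ^ j * s (n j))"
      using s_pos[of "n j"] by (intro suminf_half_ennreal) simp
    finally have "Lp_int M p ?d \<le> (1/2) ^ j * s (n j)"
      using s_pos[of "n j"] by (intro Lp_fun_nn_integral_le(2)) auto
    then have "cmod (complex_of_real (1 / c j)) powr p * Lp_int M p ?d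
        \<le> cmod (complex_of_real (1 / c j)) powr p * ((1/2) ^ j * s (n j))"
      by (intro mult_left_mono) auto
    also have "\<dots> = (1/2) ^ j"
      using c_pos[of j] s_pos[of "n j"] by (simp add: powr_divide c_powr norm_divide)
    also have "cmod (complex_of_real (1 / c j)) powr p * Lp_int M p ?d
        = Lp_int M p (\<lambda>x. complex_of_real (1 / c j) * ?d x)"
      by (rule Lp_int_scale[symmetric])
    also have "(\<lambda>x. complex_of_real (1 / c j) * ?d x) = (\<lambda>x. complex_of_real (1 / c j) * \<phi> ((f ^^ n j) x) - y j x)"
      using c_pos[of j] by (simp add: z_def right_diff_distrib flip: int_iterate_of_nat)
    finally show ?thesis .
  qed
  show ?thesis
  proof (intro bexI[OF _ \<phi>] ballI allI impI)
    fix g and \<epsilon> :: real assume g: "g \<in> Lp_fun M p" and \<epsilon>: "0 < \<epsilon>"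
    define \<delta> where "\<delta> = \<epsilon> / (2 * 2 powr p)"
    have \<delta>: "0 < \<delta>" "2 powr p * (\<delta> + \<delta>) = \<epsilon>"
      using \<epsilon> by (simp_all add: \<delta>_def)
    obtain d where d: "d \<in> D" "Lp_int M p (\<lambda>x. g x - d x) < \<delta>"
      using D(4)[OF g \<delta>(1)] by blast
    obtain J where J: "(1/2::real) ^ J < \<delta>"
      using real_arch_pow_inv[OF \<delta>(1), of "1/2"] by auto
    \<comment> \<open>The error \<open>(1/2) ^ j\<close> is tied to the index, so \<open>d\<close>
      has to recur beyond \<open>J\<close>.\<close>
    obtain j where j: "J \<le> j" "y j = d"
      using y_cofinal[OF d(1)] by blast
    have "(1/2::real) ^ j \<le> (1/2) ^ J"
      using j(1) by (intro power_decreasing) auto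
    then have 1: "Lp_int M p (\<lambda>x. complex_of_real (1 / c j) * \<phi> ((f ^^ n j) x) - d x) < \<delta>"
      using approx[of j] J unfolding j(2) by linarith
    have 2: "Lp_int M p (\<lambda>x. d x - g x) < \<delta>"
      using d(2) by (simp add: Lp_int_def norm_minus_commute)
    have "(\<lambda>x. complex_of_real (1 / c j) * \<phi> ((f ^^ n j) x)) \<in> Lp_fun M p"
      using Lp_fun_scale[OF Lp_fun_int_iterate[OF \<phi>, of "int (n j)"], of "complex_of_real (1 / c j)"]
      by (simp only: int_iterate_of_nat)
    moreover have "d \<in> Lp_fun M p"
      using d(1) D(3) finite_level_functions_subset_Lp_fun[OF p] by blast
    ultimately have "Lp_int M p (\<lambda>x. complex_of_real (1 / c j) * \<phi> ((f ^^ n j) x) - g x)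
        \<le> 2 powr p * (Lp_int M p (\<lambda>x. complex_of_real (1 / c j) * \<phi> ((f ^^ n j) x) - d x)
          + Lp_int M p (\<lambda>x. d x - g x))"
      by (intro Lp_int_triangle p g)
    also have "\<dots> < 2 powr p * (\<delta> + \<delta>)"
      using 1 2 by (intro mult_strict_left_mono add_strict_mono) auto
    finally show "\<exists>c n. Lp_int M p (\<lambda>x. c * \<phi> ((f ^^ n) x) - g x) < \<epsilon>"
      unfolding \<delta>(2) by blast
  qed
qed

end

theorem theorem4p8:
  fixes M :: "'a::{second_countable_topology, t2_space} measure"
    and f :: "'a \<Rightarrow> 'a"
    and W :: "'a set"
    and p :: real
  assumes "1 \<le> p"
    and "bounded_distortion_system M f W"
  shows "supercyclic (Lp M p) (Lp_dist M p) (Lp_scale M p) (composition_operator M p f) \<longleftrightarrow>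
    (\<forall>q::nat. 1 \<le> q \<longrightarrow>
      liminf (\<lambda>n. emeasure M (int_iterate f (int q - int n) ` W)
        * emeasure M (int_iterate f (int q + int n) ` W)) = 0)"
proof -
  interpret bounded_distortion_system M f W
    by fact
  show ?thesis
    unfolding supercyclic_iff[OF \<open>1 \<le> p\<close>] liminf_wandering_iff
    using supercyclic_imp_liminf[OF \<open>1 \<le> p\<close>] supercyclic_vector_exists[OF \<open>1 \<le> p\<close>] by blast
qed

end
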